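(* Let $z\in\mathbb{R}$ with $z\notin\omega\mathbb{Q}$, let $P=(\wp(z),\wp'(z))\in E(\mathbb{R})$, and let $s_n=nz \bmod \omega\in(0,\omega)$, $n\geq 1$, so that $[n]P=(\wp(s_n),\wp'(s_n))$. Then the points $[n]P$ are not equidistributed on $E$ with respect to the arc-length measure $\mu_\gamma$, but they are equidistributed with respect to the measure $\mu(X)=\frac1\omega\int_{\wp(X)}\frac{dx}{y}$.
   Context: Let $g_2,g_3\in\mathbb{R}$ with $g_2^3-27g_3^2\ne0$, let $\Lambda\subset\mathbb{C}$ be the lattice with invariants $g_2,g_3$, $\wp$ its Weierstrass function, $E:y^2=4x^3-g_2x-g_3$, and $\omega>0$ the smallest positive real element of $\Lambda$. The identity component of $E(\mathbb{R})$ (minus $O$) is parametrized by $\gamma(t)=(\wp(t),\wp'(t))$, $t\in(0,\omega)$. Put $\mu_\gamma(X)=\int_X\|\gamma'(t)\|\,dt$ for Borel $X\subseteq(0,\omega)$. The points $\gamma(s_n)$ are equidistributed with respect to $\mu_\gamma$ if $$\lim_{N\to\infty}\frac{\#\{n\le N:s_n\in[a,b]\cap A_k\}}{\#\{n\le N:s_n\in A_k\}}=\frac{\mu_\gamma([a,b]\cap A_k)}{\mu_\gamma(A_k)}$$ for every $[a,b]\subseteq[0,\omega]$, every $k$, and every family of open intervals $A_k=(a_k,b_k)$ with $a_k\neq0$, $b_k\neq\omega$, $A_k\subseteq A_{k+1}$ and $\bigcup_k A_k=(0,\omega)$. For Borel $X\subseteq[0,\omega]$, $\mu(X)=\frac1\omega\int_{\wp(X)}\frac{dx}{y}$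 is the integral of $dx/|y|$ over the part $\gamma(X)$ of the curve (both branches $y>0$ and $y<0$ counted), divided by $\omega$; equivalently, normalized Lebesgue measure of $X$. Equidistribution with respect to $\mu$ means $\lim_{N\to\infty}\frac1N\#\{n\le N:s_n\in[a,b]\}=\mu([a,b])$ for every $[a,b]\subseteq[0,\omega]$. *)

theory Defs
  imports "HOL-Analysis.Analysis" "HOL-Library.Real_Mod"
begin

definition is_lattice :: "complex set \<Rightarrow> bool" where
  "is_lattice \<Lambda> \<longleftrightarrow>
     (\<exists>w1 w2. w1 \<noteq> 0 \<and> w2 / w1 \<notin> \<real> \<and>
        \<Lambda> = {of_int m * w1 + of_int n * w2 |m n. True})"

definition invariant_g2 :: "complex set \<Rightarrow> complex" where
  "invariant_g2 \<Lambda> = 60 * (\<Sum>\<^sub>\<infinity>w\<in>\<Lambda> - {0}. 1 / w ^ 4)"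

definition invariant_g3 :: "complex set \<Rightarrow> complex" where
  "invariant_g3 \<Lambda> = 140 * (\<Sum>\<^sub>\<infinity>w\<in>\<Lambda> - {0}. 1 / w ^ 6)"

text \<open>The values at points of \<open>\<Lambda>\<close>, where the function has its poles, are irrelevant.\<close>

definition wp :: "complex set \<Rightarrow> complex \<Rightarrow> complex" where
  "wp \<Lambda> z = 1 / z ^ 2 + (\<Sum>\<^sub>\<infinity>w\<in>\<Lambda> - {0}. (1 / (z - w) ^ 2 - 1 / w ^ 2))"

definition is_real_period :: "complex set \<Rightarrow> real \<Rightarrow> bool" where
  "is_real_period \<Lambda> \<omega> \<longleftrightarrow>
     0 < \<omega> \<and> of_real \<omega> \<in> \<Lambda> \<and> (\<forall>t>0. of_real t \<in> \<Lambda> \<longrightarrow> \<omega> \<le> t)"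

datatype 'a ec_point = Infinity | Affine "'a \<times> 'a"

text \<open>
  The real points are regarded as points with complex coordinates, because that is where the
  values of the Weierstrass function live.
\<close>

definition real_points :: "real \<Rightarrow> real \<Rightarrow> complex ec_point set" where
  "real_points g2 g3 =
     insert Infinity
       {Affine (of_real x, of_real y) |x y. y ^ 2 = 4 * x ^ 3 - g2 * x - g3}"

text \<open>
  Chord-tangent addition on \<open>y\<^sup>2 = 4 x\<^sup>3 - g2 x - g3\<close>. Substituting the line
  \<open>y = l x + c\<close> into the equation shows that the abscissae of the three intersection points sum
  to \<open>l\<^sup>2 / 4\<close>. The sum is the reflection of the third point, and \<open>g3\<close> does not
  enter the formulas.
\<close>

fun ec_add :: "'a::field \<Rightarrow> 'a ec_point \<Rightarrow> 'a ec_point \<Rightarrow> 'a ec_point" where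
  "ec_add g2 Infinity Q = Q"
| "ec_add g2 P Infinity = P"
| "ec_add g2 (Affine (x1, y1)) (Affine (x2, y2)) =
     (if x1 = x2 \<and> y1 = - y2 then Infinity
      else let l = (if x1 = x2 then (12 * x1 ^ 2 - g2) / (2 * y1) else (y2 - y1) / (x2 - x1));
               x3 = l ^ 2 / 4 - x1 - x2
           in Affine (x3, l * (x1 - x3) - y1))"

definition ec_mult :: "'a::field \<Rightarrow> nat \<Rightarrow> 'a ec_point \<Rightarrow> 'a ec_point" where
  "ec_mult g2 n P = (ec_add g2 P ^^ n) Infinity"

definition gam :: "complex set \<Rightarrow> real \<Rightarrow> complex \<times> complex" where
  "gam \<Lambda> t = (wp \<Lambda> (of_real t), deriv (wp \<Lambda>) (of_real t))"

text \<open>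
  On \<open>\<complex>\<^sup>2\<close> the norm is the Euclidean one, so for a curve with real coordinates this is
  the usual arc length.
\<close>

definition arc_measure :: "complex set \<Rightarrow> real set \<Rightarrow> ennreal" where
  "arc_measure \<Lambda> X =
     (\<integral>\<^sup>+t\<in>X. ennreal (norm (vector_derivative (gam \<Lambda>) (at t))) \<partial>lborel)"

text \<open>
  The abscissae of the points of \<open>\<gamma>(X)\<close> lying on the branch with \<open>sgn y = \<sigma>\<close>. The
  endpoints \<open>0\<close> and \<open>\<omega>\<close> correspond to the point at infinity and are left out.
\<close>

definition branch_abscissae :: "complex set \<Rightarrow> real \<Rightarrow> real \<Rightarrow> real set \<Rightarrow> real set" where
  "branch_abscissae \<Lambda> \<omega> \<sigma> X =
     {x. \<exists>y. sgn y = \<sigma> \<and> (of_real x, of_real y) \<in> gam \<Lambda> ` (X \<inter> {0<..<\<omega>})}"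

text \<open>
  The integral of \<open>dx / \<bar>y\<bar>\<close> over \<open>\<gamma>(X)\<close>, divided by \<open>\<omega>\<close>. The points with
  \<open>y = 0\<close> have finitely many abscissae and contribute nothing.
\<close>

definition dxy_measure :: "real \<Rightarrow> real \<Rightarrow> complex set \<Rightarrow> real \<Rightarrow> real set \<Rightarrow> ennreal" where
  "dxy_measure g2 g3 \<Lambda> \<omega> X =
     ((\<integral>\<^sup>+x\<in>branch_abscissae \<Lambda> \<omega> 1 X. ennreal (1 / sqrt (4 * x ^ 3 - g2 * x - g3)) \<partial>lborel) +
      (\<integral>\<^sup>+x\<in>branch_abscissae \<Lambda> \<omega> (-1) X. ennreal (1 / sqrt (4 * x ^ 3 - g2 * x - g3)) \<partial>lborel))
     / ennreal \<omega>"

definition visits :: "(nat \<Rightarrow> real) \<Rightarrow> real set \<Rightarrow> nat \<Rightarrow> nat" where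
  "visits s X N = card {n \<in> {1..N}. s n \<in> X}"

definition exhausting_intervals :: "real \<Rightarrow> (nat \<Rightarrow> real) \<Rightarrow> (nat \<Rightarrow> real) \<Rightarrow> bool" where
  "exhausting_intervals \<omega> a b \<longleftrightarrow>
     (\<forall>k. a k < b k \<and> a k \<noteq> 0 \<and> b k \<noteq> \<omega> \<and> {a k<..<b k} \<subseteq> {a (Suc k)<..<b (Suc k)}) \<and>
     (\<Union>k. {a k<..<b k}) = {0<..<\<omega>}"

definition equidistributed_arc :: "complex set \<Rightarrow> real \<Rightarrow> (nat \<Rightarrow> real) \<Rightarrow> bool" where
  "equidistributed_arc \<Lambda> \<omega> s \<longleftrightarrow>
     (\<forall>c d a b k. 0 \<le> c \<and> c \<le> d \<and> d \<le> \<omega> \<and> exhausting_intervals \<omega> a b \<longrightarrow>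
        (\<lambda>N. real (visits s ({c..d} \<inter> {a k<..<b k}) N) / real (visits s {a k<..<b k} N))
          \<longlonglongrightarrow> enn2real (arc_measure \<Lambda> ({c..d} \<inter> {a k<..<b k}) / arc_measure \<Lambda> {a k<..<b k}))"

definition equidistributed_dxy :: "real \<Rightarrow> real \<Rightarrow> complex set \<Rightarrow> real \<Rightarrow> (nat \<Rightarrow> real) \<Rightarrow> bool" where
  "equidistributed_dxy g2 g3 \<Lambda> \<omega> s \<longleftrightarrow>
     (\<forall>c d. 0 \<le> c \<and> c \<le> d \<and> d \<le> \<omega> \<longrightarrow>
        (\<lambda>N. real (visits s {c..d} N) / real N) \<longlonglongrightarrow> enn2real (dxy_measure g2 g3 \<Lambda> \<omega> {c..d}))"

end

theory Submission
  imports Defs "HOL-Complex_Analysis.Complex_Analysis"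
begin

text \<open>
  The function \<open>wp\<close> satisfies the two usual differential equations by Liouville's theorem. If
  \<open>p\<close> and \<open>q\<close> solve these equations with a pole \<open>1 / z\<^sup>2\<close> at \<open>0\<close>, then Euler's
  computation shows that \<open>((p' u - q' w) / (p u - q w))\<^sup>2 / 4 - p u - q w\<close> depends on \<open>u + w\<close>
  only, and is equal both to \<open>p (u + w)\<close> and to \<open>q (u + w)\<close>. For \<open>q = p\<close> this is the
  addition theorem; for \<open>q\<close> the complex conjugate of \<open>wp\<close> it shows that \<open>wp\<close> is real on
  the real axis.

  The sequence \<open>n z mod \<omega>\<close> is equidistributed for Lebesgue measure, and \<open>dx / \<bar>y\<bar>\<close> pulls
  back to Lebesgue measure because \<open>wp'\<close> is the derivative of \<open>wp\<close>. Equidistribution for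
  arc length would make the arc length of \<open>[c, d]\<close> a constant multiple of \<open>d - c\<close>, but the
  speed of the curve is unbounded near \<open>0\<close>.
\<close>

text \<open>The hypotheses make the invariants real but say nothing about the conjugate of
  \<open>L\<close>, so reality of \<open>wp\<close> on the real axis cannot be read off from its
  series. It has to come out of the differential equations, in a comparison of two functions whose
  pole sets are not known to agree. Hence \<open>weierstrass_solution\<close> speaks of an arbitrary
  closed countable set of poles. Countability fits both uses of such sets: the complement of a
  countable set in the plane is connected, and an identity of continuous functions that holds off
  such a set holds throughout.

  The chord formulas have exceptional cases, and multiplying out the denominators removes them. The
  cleared addition theorem extends by continuity to equal abscissae, and its limit is the
  duplication formula. Read at the degenerate points, these cleared identities tell where
  \<open>wp'\<close> can vanish and which parameters share an abscissa.

  For the rotation, only upper bounds on the number of visits are counted directly; the lower bounds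
  come from the complementary intervals.\<close>

section \<open>Equidistribution of irrational rotations\<close>

lemma visits_mono: "X \<subseteq> Y \<Longrightarrow> visits s X N \<le> visits s Y N"
  unfolding visits_def by (intro card_mono) auto

lemma visits_Un_le: "visits s (X \<union> Y) N \<le> visits s X N + visits s Y N"
proof -
  have "{n \<in> {1..N}. s n \<in> X \<union> Y} = {n \<in> {1..N}. s n \<in> X} \<union> {n \<in> {1..N}. s n \<in> Y}"
    by auto
  then show ?thesis
    unfolding visits_def by (simp only: card_Un_le)
qed

lemma visits_UN_le:
  assumes "finite I"
  shows "visits s (\<Union>i\<in>I. X i) N \<le> (\<Sum>i\<in>I. visits s (X i) N)"
  using assms
proof induction
  case (insert i I)
  have "visits s (\<Union>i\<in>insert i I. X i) N \<le> visits s (X i) N + visits s (\<Union>i\<in>I. X i) N"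
    using visits_Un_le[of s "X i" "\<Union>i\<in>I. X i" N] by simp
  with insert show ?case by simp
qed (simp add: visits_def)

text \<open>The shift of the index by \<open>k\<close> pushes at most the last \<open>k\<close>
  visits beyond \<open>N\<close>.\<close>

lemma visits_shift_le:
  "visits s X N \<le> card {n \<in> {k<..N}. s (n - k) \<in> X} + k"
proof -
  have "{n \<in> {1..N}. s n \<in> X} \<subseteq> (\<lambda>n. n - k) ` {n \<in> {k<..N}. s (n - k) \<in> X} \<union> {N - k<..N}"
  proof
    fix n assume n: "n \<in> {n \<in> {1..N}. s n \<in> X}"
    show "n \<in> (\<lambda>n. n - k) ` {n \<in> {k<..N}. s (n - k) \<in> X} \<union> {N - k<..N}"
    proof (cases "n + k \<le> N")
      case True
      then have "n + k \<in> {n \<in> {k<..N}. s (n - k) \<in> X}" using n by auto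
      then show ?thesis by (intro UnI1 image_eqI[of _ _ "n + k"]) auto
    next
      case False
      then show ?thesis using n by auto
    qed
  qed
  then have "visits s X N \<le> card ((\<lambda>n. n - k) ` {n \<in> {k<..N}. s (n - k) \<in> X} \<union> {N - k<..N})"
    unfolding visits_def by (intro card_mono) auto
  also have "\<dots> \<le> card ((\<lambda>n. n - k) ` {n \<in> {k<..N}. s (n - k) \<in> X}) + card {N - k<..N}"
    by (rule card_Un_le)
  also have "card ((\<lambda>n. n - k) ` {n \<in> {k<..N}. s (n - k) \<in> X}) \<le> card {n \<in> {k<..N}. s (n - k) \<in> X}"
    by (intro card_image_le) auto
  also have "card {N - k<..N} \<le> k" by simp
  finally show ?thesis by simp
qed

text \<open>
  There are \<open>m\<close> pairwise disjoint translates of a short interval by multiples of \<open>\<alpha>\<close>,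
  and the orbit visits all of them equally often up to a bounded error.
\<close>

lemma visits_short_interval:
  fixes \<alpha> l a :: real
  assumes irr: "\<alpha> \<notin> \<rat>" and m: "m > 0" and l: "0 \<le> l" "l < 1 / real m"
  shows "\<exists>C. \<forall>N. m * visits (\<lambda>n. frac (real n * \<alpha>)) {a..a + l} N \<le> N + C"
proof -
  \<comment> \<open>By density of the orbit, some \<open>k i\<close> brings
    \<open>frac (k i * \<alpha>)\<close> within \<eta> of i/m. The choice of \<eta> makes l +
    2\<eta> equal to 1/m, so translates of an interval of length \<open>l\<close> by these amounts
    cannot meet modulo 1.\<close>
  define \<eta> where "\<eta> = (1 / real m - l) / 2"
  have \<eta>: "\<eta> > 0" using l by (simp add: \<eta>_def)
  have "\<exists>k. \<bar>frac (real k * \<alpha>) - real i / real m\<bar> < \<eta>" if "i < m" for i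
  proof -
    have "0 \<le> real i / real m" "real i / real m \<le> 1" using that by auto
    from Kronecker_approx_1_explicit[OF irr this \<eta>] show ?thesis by blast
  qed
  then have "\<forall>i. \<exists>k. i < m \<longrightarrow> \<bar>frac (real k * \<alpha>) - real i / real m\<bar> < \<eta>"
    by blast
  from choice[OF this] obtain k :: "nat \<Rightarrow> nat"
    where k: "\<And>i. i < m \<Longrightarrow> \<bar>frac (real (k i) * \<alpha>) - real i / real m\<bar> < \<eta>"
    by blast
  \<comment> \<open>The orbit is in the interval at time \<open>n - k i\<close> exactly when at time
    \<open>n\<close> it is in the translate by \<open>k i * \<alpha>\<close>, modulo 1.\<close>
  define V where "V = (\<lambda>i N. {n \<in> {k i<..N}. frac (real (n - k i) * \<alpha>) \<in> {a..a + l}})"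
  have disj: "V i N \<inter> V j N = {}" if ij: "i < j" "j < m" for i j N
  proof (rule ccontr)
    assume "V i N \<inter> V j N \<noteq> {}"
    then obtain n where "n \<in> V i N" "n \<in> V j N" by blast
    then have n: "k i < n" "k j < n"
      "frac (real (n - k i) * \<alpha>) \<in> {a..a + l}" "frac (real (n - k j) * \<alpha>) \<in> {a..a + l}"
      by (simp_all only: V_def mem_Collect_eq greaterThanAtMost_iff)
    \<comment> \<open>Fractional parts are additive only modulo 1; \<open>p\<close> collects the
      floors.\<close>
    define p where "p = \<lfloor>real (n - k i) * \<alpha>\<rfloor> - \<lfloor>real (n - k j) * \<alpha>\<rfloor>
      + \<lfloor>real (k i) * \<alpha>\<rfloor> - \<lfloor>real (k j) * \<alpha>\<rfloor>"
    have "frac (real (n - k i) * \<alpha>) - frac (real (n - k j) * \<alpha>)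
        = frac (real (k j) * \<alpha>) - frac (real (k i) * \<alpha>) - of_int p"
      using n by (simp add: frac_def p_def of_nat_diff algebra_simps)
    then have 1: "\<bar>frac (real (k j) * \<alpha>) - frac (real (k i) * \<alpha>) - of_int p\<bar> \<le> l"
      using n by auto
    have 2: "\<bar>real j / real m - real i / real m - of_int p\<bar> < l + 2 * \<eta>"
      using 1 k[of i] k[of j] ij by linarith
    have e: "l + 2 * \<eta> = 1 / real m" by (simp add: \<eta>_def diff_divide_distrib)
    have "real_of_int (int j - int i - p * int m) = (real j / real m - real i / real m - of_int p) * real m"
      using m by (simp add: left_diff_distrib)
    then have "\<bar>real_of_int (int j - int i - p * int m)\<bar>
        = \<bar>real j / real m - real i / real m - of_int p\<bar> * real m"
      by (simp add: abs_mult)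
    also have "\<dots> < 1 / real m * real m"
      using 2 m unfolding e by (intro mult_strict_right_mono) simp_all
    also have "\<dots> = 1" using m by simp
    finally have "\<bar>int j - int i - p * int m\<bar> < 1" by linarith
    then have e: "int j - int i = p * int m" by linarith
    have "0 < p * int m" "p * int m < 1 * int m" using ij e by linarith+
    then have "0 < p" "p < 1" using m
      by (simp_all add: zero_less_mult_iff)
    then show False by simp
  qed
  have disj': "V i N \<inter> V j N = {}" if "i \<noteq> j" "i < m" "j < m" for i j N
    using that disj[of i j N] disj[of j i N] by (metis Int_commute linorder_neqE_nat)
  have "m * visits (\<lambda>n. frac (real n * \<alpha>)) {a..a + l} N \<le> N + (\<Sum>i<m. k i)" for N
  proof -
    have "(\<Sum>i<m. card (V i N)) = card (\<Union>i<m. V i N)"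
      by (rule card_UN_disjoint[symmetric]) (simp_all add: disj', simp_all add: V_def)
    also have "\<dots> \<le> card {1..N}"
      by (intro card_mono) (auto simp: V_def)
    finally have *: "(\<Sum>i<m. card (V i N)) \<le> N" by simp
    have "m * visits (\<lambda>n. frac (real n * \<alpha>)) {a..a + l} N
        = (\<Sum>i<m. visits (\<lambda>n. frac (real n * \<alpha>)) {a..a + l} N)" by simp
    also have "\<dots> \<le> (\<Sum>i<m. card (V i N) + k i)"
      unfolding V_def by (intro sum_mono visits_shift_le)
    finally show ?thesis using * by (simp add: sum.distrib)
  qed
  then show ?thesis by blast
qed

text \<open>Cut the interval into \<open>r\<close> pieces shorter than 1/m, with r at most m(d - c)
  + 1. Each piece has at most N/m visits up to a constant, which gives d - c + 1/m in the limit. One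
  half of \<epsilon> pays for 1/m, the other for the constants.\<close>

lemma visits_interval_upper:
  fixes \<alpha> c d \<epsilon> :: real
  assumes irr: "\<alpha> \<notin> \<rat>" and cd: "c \<le> d" and \<epsilon>: "\<epsilon> > 0"
  shows "\<forall>\<^sub>F N in sequentially.
    real (visits (\<lambda>n. frac (real n * \<alpha>)) {c..d} N) \<le> (d - c + \<epsilon>) * real N"
proof -
  let ?v = "\<lambda>X N. visits (\<lambda>n. frac (real n * \<alpha>)) X N"
  obtain m :: nat where m: "1 / real m < \<epsilon> / 2" "m > 0"
    using \<epsilon> by (metis half_gt_zero gr_zeroI inverse_eq_divide real_arch_inverse)
  \<comment> \<open>One more than the floor, so that the pieces are strictly shorter than
    1/m.\<close>
  define r where "r = nat \<lfloor>real m * (d - c)\<rfloor> + 1"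
  define l where "l = (d - c) / real r"
  have r: "real m * (d - c) < real r" "real r \<le> real m * (d - c) + 1" "r > 0"
  proof -
    define x where "x = real m * (d - c)"
    have "x \<ge> 0" using cd by (simp add: x_def)
    then show "x < real r" "real r \<le> x + 1" "r > 0"
      unfolding r_def x_def[symmetric] by linarith+
  qed
  have l: "0 \<le> l" "l < 1 / real m"
    using r m cd by (auto simp: l_def field_simps)
  have "\<exists>C. \<forall>N. m * ?v {a..a + l} N \<le> N + C" for a
    using visits_short_interval[OF irr m(2) l] .
  then obtain C where C: "\<And>a N. m * ?v {a..a + l} N \<le> N + C a" by metis
  define K where "K = (\<Sum>i<r. C (c + real i * l))"
  have cover: "{c..d} \<subseteq> (\<Union>i<r. {c + real i * l..c + real i * l + l})"
  proof
    fix x assume x: "x \<in> {c..d}"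
    show "x \<in> (\<Union>i<r. {c + real i * l..c + real i * l + l})"
    \<comment> \<open>At \<open>x = d\<close> the floor used below would give the index
      \<open>r\<close>, one too many; if \<open>c = d\<close>, then moreover
      \<open>l = 0\<close>.\<close>
    proof (cases "x = d")
      case True
      have "real (r - 1) * l + l = real r * l"
        using r(3) by (simp add: of_nat_diff left_diff_distrib)
      also have "\<dots> = d - c" using r(3) by (simp add: l_def)
      finally have "real (r - 1) * l + l = d - c" .
      with True l r(3) show ?thesis
        by (intro UN_I[of "r - 1"]) auto
    next
      case False
      then have lt: "c \<le> x" "x < d" using x by auto
      then have l0: "l > 0" using r by (simp add: l_def)
      define i where "i = nat \<lfloor>(x - c) / l\<rfloor>"
      have i1: "real i \<le> (x - c) / l" "(x - c) / l < real i + 1"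
      proof -
        have "0 \<le> (x - c) / l" using lt l0 by simp
        then show "real i \<le> (x - c) / l" "(x - c) / l < real i + 1"
          unfolding i_def by linarith+
      qed
      have lr: "real r * l = d - c" using r(3) by (simp add: l_def)
      have i2: "real i * l \<le> x - c" "x - c \<le> real i * l + l"
        using i1 l0 by (simp_all add: pos_le_divide_eq pos_divide_less_eq distrib_right)
      have "real i * l < real r * l" using i2 lr lt by linarith
      then have "i < r" using l0 by simp
      with i2 show ?thesis by (intro UN_I[of i]) auto
    qed
  qed
  have main: "real m * real (?v {c..d} N) \<le> real r * real N + real K" for N
  proof -
    have "m * ?v {c..d} N \<le> m * (\<Sum>i<r. ?v {c + real i * l..c + real i * l + l} N)"
      by (intro mult_left_mono order_trans[OF visits_mono[OF cover] visits_UN_le]) auto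
    also have "\<dots> \<le> (\<Sum>i<r. N + C (c + real i * l))"
      unfolding sum_distrib_left by (intro sum_mono C)
    also have "\<dots> = r * N + K" by (simp add: sum.distrib K_def)
    finally show ?thesis by (metis of_nat_add of_nat_le_iff of_nat_mult)
  qed
  have "\<forall>\<^sub>F N in sequentially. real N \<ge> 2 * real K / (real m * \<epsilon>)"
    using filterlim_real_sequentially by (auto simp: filterlim_at_top)
  then show ?thesis
  proof eventually_elim
    case (elim N)
    have "real K \<le> (\<epsilon> / 2) * real m * real N"
      using elim m \<epsilon> by (simp add: field_simps)
    moreover have "real r * real N \<le> (real m * (d - c) + \<epsilon> / 2 * real m) * real N"
      using r(2) m by (intro mult_right_mono) (auto simp: field_simps)
    ultimately have "real m * real (?v {c..d} N) \<le> real m * ((d - c + \<epsilon>) * real N)"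
      using main[of N] by (simp add: algebra_simps)
    then show ?case using m by simp
  qed
qed

text \<open>The upper bound for [0, c] and [d, 1] is a lower bound for what lies between them.
  Leaving the endpoints of \<open>X\<close> free covers both the closed test intervals and the open
  intervals of an exhausting family.\<close>

theorem equidistribution_frac:
  fixes \<alpha> c d :: real
  assumes irr: "\<alpha> \<notin> \<rat>" and cd: "0 \<le> c" "c \<le> d" "d \<le> 1"
    and X: "{c<..<d} \<subseteq> X" "X \<subseteq> {c..d}"
  shows "(\<lambda>N. real (visits (\<lambda>n. frac (real n * \<alpha>)) X N) / real N) \<longlonglongrightarrow> d - c"
proof (rule LIMSEQ_I)
  let ?v = "\<lambda>X N. visits (\<lambda>n. frac (real n * \<alpha>)) X N"
  fix r :: real assume r: "r > 0"
  have 1: "\<forall>\<^sub>F N in sequentially. real (?v {c..d} N) \<le> (d - c + r / 3) * real N"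
    using visits_interval_upper[OF irr cd(2)] r by simp
  have 2: "\<forall>\<^sub>F N in sequentially. real (?v {0..c} N) \<le> (c - 0 + r / 3) * real N"
    using visits_interval_upper[OF irr cd(1)] r by simp
  have 3: "\<forall>\<^sub>F N in sequentially. real (?v {d..1} N) \<le> (1 - d + r / 3) * real N"
    using visits_interval_upper[OF irr cd(3)] r by simp
  have 4: "N \<le> ?v X N + ?v {0..c} N + ?v {d..1} N" for N
  proof -
    have "{n \<in> {1..N}. frac (real n * \<alpha>) \<in> {0..1}} = {1..N}"
      by (auto simp: less_imp_le[OF frac_lt_1])
    then have "N = ?v {0..1} N" by (simp add: visits_def)
    also have "\<dots> \<le> ?v ((X \<union> {0..c}) \<union> {d..1}) N"
      by (rule visits_mono) (use X in force)
    also have "\<dots> \<le> ?v X N + ?v {0..c} N + ?v {d..1} N"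
      by (intro order_trans[OF visits_Un_le] add_right_mono visits_Un_le)
    finally show ?thesis .
  qed
  have "\<forall>\<^sub>F N in sequentially. norm (real (?v X N) / real N - (d - c)) < r"
    using 1 2 3 eventually_gt_at_top[of 0]
  proof eventually_elim
    case (elim N)
    have "real (?v X N) \<le> (d - c + r / 3) * real N"
      using elim(1) visits_mono[OF X(2), of "\<lambda>n. frac (real n * \<alpha>)" N] by linarith
    moreover have "real N \<le> real (?v X N) + (c - 0 + r / 3) * real N + (1 - d + r / 3) * real N"
      using 4[of N] elim(2,3) by linarith
    then have "(d - c - 2 * r / 3) * real N \<le> real (?v X N)"
      by (simp add: algebra_simps)
    ultimately have "real (?v X N) / real N \<le> d - c + r / 3" "d - c - 2 * r / 3 \<le> real (?v X N) / real N"
      using elim(4) by (simp_all add: field_simps)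
    then show ?case using r by (auto simp: abs_if)
  qed
  then show "\<exists>no. \<forall>n\<ge>no. norm (real (?v X n) / real n - (d - c)) < r"
    by (simp add: eventually_sequentially)
qed

section \<open>Lattices in the complex plane\<close>

text \<open>After division by \<open>w1\<close> the imaginary part of m + n\<tau> is n Im \<tau>. It
  bounds \<open>n\<close>, and the triangle inequality then bounds \<open>m\<close>.\<close>

lemma lattice_norm_bound:
  fixes w1 w2 :: complex
  assumes "w1 \<noteq> 0" "w2 / w1 \<notin> \<real>"
  shows "\<exists>C>0. \<forall>m n::int. \<bar>of_int m\<bar> + \<bar>of_int n\<bar> \<le> C * norm (of_int m * w1 + of_int n * w2)"
proof -
  define \<tau> where "\<tau> = w2 / w1"
  define y where "y = \<bar>Im \<tau>\<bar>"
  have y: "y > 0" using assms(2) by (auto simp: y_def \<tau>_def complex_is_Real_iff)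
  define C where "C = (1 / y + 1 + norm \<tau> / y) / norm w1"
  have "\<bar>of_int m\<bar> + \<bar>of_int n\<bar> \<le> C * norm (of_int m * w1 + of_int n * w2)" for m n :: int
  proof -
    define u where "u = of_int m + of_int n * \<tau>"
    have e: "of_int m * w1 + of_int n * w2 = w1 * u"
      using assms(1) by (simp add: u_def \<tau>_def algebra_simps)
    have "\<bar>of_int n\<bar> * y = \<bar>Im u\<bar>" by (simp add: u_def y_def abs_mult)
    also have "\<dots> \<le> norm u" by (rule abs_Im_le_cmod)
    finally have n: "\<bar>of_int n\<bar> \<le> norm u / y" using y by (simp add: pos_le_divide_eq)
    have "\<bar>of_int m :: real\<bar> = norm (u - of_int n * \<tau>)" by (simp add: u_def)
    also have "\<dots> \<le> norm u + norm (of_int n * \<tau>)" by (rule norm_triangle_ineq4)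
    also have "norm (of_int n * \<tau>) \<le> norm u / y * norm \<tau>"
      using mult_right_mono[OF n, of "norm \<tau>"] by (simp add: norm_mult)
    finally have "\<bar>of_int m\<bar> + \<bar>of_int n\<bar> \<le> norm u * (1 / y + 1 + norm \<tau> / y)"
      using n by (simp add: distrib_left)
    also have "\<dots> = C * norm (w1 * u)" using assms(1) by (simp add: C_def norm_mult)
    finally show ?thesis unfolding e .
  qed
  moreover have "C > 0"
  proof -
    have "1 / y > 0" "norm \<tau> / y \<ge> 0" using y by simp_all
    then have "1 / y + 1 + norm \<tau> / y > 0" by linarith
    then show ?thesis using assms(1) by (simp add: C_def)
  qed
  ultimately show ?thesis by blast
qed

text \<open>The exponent is half of 3: the cubic lattice sum will be dominated by a product of two
  such series, one for each coordinate.\<close>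

lemma summable_on_int_powr: "(\<lambda>m::int. (1 + \<bar>of_int m\<bar>) powr (-3/2) :: real) summable_on UNIV"
proof -
  have "summable (\<lambda>n. real n powr (-3/2))"
    by (subst summable_real_powr_iff) simp
  then have "summable (\<lambda>n. real (Suc n) powr (-3/2))"
    by (subst summable_Suc_iff)
  then have 1: "(\<lambda>n::nat. (1 + real n) powr (-3/2)) summable_on UNIV"
    by (subst summable_on_UNIV_nonneg_real_iff) (simp_all add: add.commute)
  have 2: "(\<lambda>m::int. (1 + \<bar>of_int m\<bar>) powr (-3/2) :: real) summable_on range int"
    using 1 by (subst summable_on_reindex) (simp_all add: inj_def o_def)
  have 3: "(\<lambda>m::int. (1 + \<bar>of_int m\<bar>) powr (-3/2) :: real) summable_on range (\<lambda>n. - int n)"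
    using 1 by (subst summable_on_reindex) (simp_all add: inj_def o_def)
  have "(UNIV :: int set) = range int \<union> (range (\<lambda>n. - int n) - range int)"
  proof (intro equalityI subsetI)
    fix m :: int
    have "m \<in> range int \<or> m \<in> range (\<lambda>n. - int n)"
      by (cases m rule: int_cases2) blast+
    then show "m \<in> range int \<union> (range (\<lambda>n. - int n) - range int)" by blast
  qed simp
  moreover have "(\<lambda>m::int. (1 + \<bar>of_int m\<bar>) powr (-3/2) :: real)
      summable_on (range (\<lambda>n. - int n) - range int)"
    by (rule summable_on_subset_banach[OF 3]) blast
  ultimately show ?thesis
    using summable_on_Un_disjoint[OF 2 _ Diff_disjoint, of "range (\<lambda>n. - int n)"] by simp
qed

locale complex_lattice =
  fixes L :: "complex set"
  assumes lattice: "is_lattice L"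
begin

lemma basis_obtain:
  obtains w1 w2 C where "w1 \<noteq> 0" "w2 / w1 \<notin> \<real>"
    "L = {of_int m * w1 + of_int n * w2 |m n. True}" "C > 0"
    "\<And>m n::int. \<bar>of_int m\<bar> + \<bar>of_int n\<bar> \<le> C * norm (of_int m * w1 + of_int n * w2)"
proof -
  obtain w1 w2 where w: "w1 \<noteq> 0" "w2 / w1 \<notin> \<real>" "L = {of_int m * w1 + of_int n * w2 |m n. True}"
    using lattice unfolding is_lattice_def by blast
  from lattice_norm_bound[OF w(1,2)] show ?thesis using that[OF w] by blast
qed

lemma zero_in [simp]: "0 \<in> L"
proof (rule basis_obtain)
  fix w1 w2 assume L: "L = {of_int m * w1 + of_int n * w2 |m n. True}"
  have "0 = of_int 0 * w1 + of_int 0 * w2" by simp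
  then show ?thesis unfolding L by blast
qed

lemma add_in: "x \<in> L \<Longrightarrow> y \<in> L \<Longrightarrow> x + y \<in> L"
proof (rule basis_obtain)
  fix w1 w2 assume L: "L = {of_int m * w1 + of_int n * w2 |m n. True}"
  assume "x \<in> L" "y \<in> L"
  then obtain m n m' n' where "x = of_int m * w1 + of_int n * w2" "y = of_int m' * w1 + of_int n' * w2"
    unfolding L by blast
  then have "x + y = of_int (m + m') * w1 + of_int (n + n') * w2"
    by (simp add: algebra_simps)
  then show ?thesis unfolding L by blast
qed

lemma minus_in: "x \<in> L \<Longrightarrow> - x \<in> L"
proof (rule basis_obtain)
  fix w1 w2 assume L: "L = {of_int m * w1 + of_int n * w2 |m n. True}"
  assume "x \<in> L"
  then obtain m n where "x = of_int m * w1 + of_int n * w2"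
    unfolding L by blast
  then have "- x = of_int (- m) * w1 + of_int (- n) * w2"
    by (simp add: algebra_simps)
  then show ?thesis unfolding L by blast
qed

lemma minus_iff [simp]: "- x \<in> L \<longleftrightarrow> x \<in> L"
proof
  assume "- x \<in> L"
  from minus_in[OF this] show "x \<in> L" by simp
qed (rule minus_in)

lemma diff_in: "x \<in> L \<Longrightarrow> y \<in> L \<Longrightarrow> x - y \<in> L"
  using add_in[OF _ minus_in, of x y] by simp

lemma add_iff: "w \<in> L \<Longrightarrow> x + w \<in> L \<longleftrightarrow> x \<in> L"
proof
  assume "w \<in> L" "x + w \<in> L"
  from diff_in[OF this(2,1)] show "x \<in> L" by simp
qed (rule add_in)

lemma of_int_mult_in: "x \<in> L \<Longrightarrow> of_int k * x \<in> L"
proof (rule basis_obtain)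
  fix w1 w2 assume L: "L = {of_int m * w1 + of_int n * w2 |m n. True}"
  assume "x \<in> L"
  then obtain m n where "x = of_int m * w1 + of_int n * w2"
    unfolding L by blast
  then have "of_int k * x = of_int (k * m) * w1 + of_int (k * n) * w2"
    by (simp add: algebra_simps)
  then show ?thesis unfolding L by blast
qed

text \<open>With s = |m| + |n|, which is at most C|w|, the product (1 + |m|)(1 + |n|) is at most
  (2s)^2. Raised to the power 3/2 this gives the majorant with constant 8C^3, a product over the two
  coordinates.\<close>

lemma summable_norm_cube: "(\<lambda>w. 1 / norm w ^ 3) summable_on L"
proof (rule basis_obtain)
  fix w1 w2 and C :: real
  assume L: "L = {of_int m * w1 + of_int n * w2 |m n. True}" and C: "C > 0"
    and bd: "\<And>m n::int. \<bar>of_int m\<bar> + \<bar>of_int n\<bar> \<le> C * norm (of_int m * w1 + of_int n * w2)"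
  define g where "g = (\<lambda>m::int. (1 + \<bar>of_int m\<bar>) powr (-3/2) :: real)"
  define h where "h = (\<lambda>(m::int, n::int). of_int m * w1 + of_int n * w2)"
  have L': "L = h ` (UNIV \<times> UNIV)" unfolding L h_def by auto
  have inj: "inj h"
  proof (rule injI, clarsimp simp: h_def)
    fix m n m' n' :: int
    assume "of_int m * w1 + of_int n * w2 = of_int m' * w1 + of_int n' * w2"
    then have "of_int (m - m') * w1 + of_int (n - n') * w2 = 0"
      by (simp add: algebra_simps)
    with bd[of "m - m'" "n - n'"] have "\<bar>real_of_int (m - m')\<bar> + \<bar>real_of_int (n - n')\<bar> \<le> 0"
      by simp
    then show "m = m' \<and> n = n'" by linarith
  qed
  have "((\<lambda>m. g m) has_sum (infsum g UNIV)) UNIV"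
    unfolding g_def by (intro has_sum_infsum summable_on_int_powr)
  then have "((\<lambda>n. g m * g n) has_sum (g m * infsum g UNIV)) UNIV" for m
    by (intro has_sum_cmult_right)
  moreover have "(\<lambda>m. g m * infsum g UNIV) summable_on UNIV"
    unfolding g_def by (intro summable_on_cmult_left summable_on_int_powr)
  ultimately have "(\<lambda>(m, n). g m * g n) summable_on (UNIV \<times> UNIV)"
    by (intro summable_on_SigmaI[where g = "\<lambda>m. g m * infsum g UNIV"]) (simp_all add: g_def)
  then have "(\<lambda>x. 8 * C ^ 3 * (case x of (m, n) \<Rightarrow> g m * g n)) summable_on (UNIV \<times> UNIV)"
    by (rule summable_on_cmult_right)
  then have "(\<lambda>x. 1 / norm (h x) ^ 3) summable_on (UNIV \<times> UNIV)"
  proof (rule summable_on_comparison_test)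
    fix x :: "int \<times> int"
    obtain m n where x: "x = (m, n)" by force
    show "1 / norm (h x) ^ 3 \<le> 8 * C ^ 3 * (case x of (m, n) \<Rightarrow> g m * g n)"
    \<comment> \<open>At the origin the term is 1/0 = 0. Elsewhere s is at least 1, which absorbs
      the summands 1 of the two factors.\<close>
    proof (cases "x = (0, 0)")
      case True
      then show ?thesis using C by (simp add: h_def g_def)
    next
      case False
      define s where "s = \<bar>real_of_int m\<bar> + \<bar>real_of_int n\<bar>"
      have "m \<noteq> 0 \<or> n \<noteq> 0" using False x by simp
      then have s1: "s \<ge> 1" unfolding s_def by linarith
      define q where "q = (1 + \<bar>real_of_int m\<bar>) * (1 + \<bar>real_of_int n\<bar>)"
      have q0: "q > 0" unfolding q_def by (intro mult_pos_pos) linarith+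
      have "q \<le> (2 * s) * (2 * s)"
        unfolding q_def by (intro mult_mono) (use s1 in \<open>auto simp: s_def\<close>)
      then have "q powr (3/2) \<le> ((2 * s) * (2 * s)) powr (3/2)"
        using q0 by (intro powr_mono2) auto
      also have "\<dots> = (2 * s) powr (3/2 + 3/2)"
        using s1 by (subst powr_mult) (simp_all flip: powr_add)
      also have "\<dots> = (2 * s) ^ 3"
        using s1 by simp
      finally have q: "q powr (3/2) \<le> 8 * s ^ 3" by (simp add: power_mult_distrib)
      have s: "s \<le> C * norm (h x)" using bd[of m n] by (simp add: s_def h_def x)
      have hp: "norm (h x) > 0" using s s1 C by (smt (verit) mult_nonneg_nonpos)
      have "s ^ 3 \<le> (C * norm (h x)) ^ 3" using s s1 by (intro power_mono) auto
      with q have "q powr (3/2) \<le> 8 * C ^ 3 * norm (h x) ^ 3" by (simp add: power_mult_distrib)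
      then have "1 / norm (h x) ^ 3 \<le> 8 * C ^ 3 / q powr (3/2)"
        using hp q0 by (simp add: field_simps)
      also have "\<dots> = 8 * C ^ 3 * q powr (-3/2)"
        by (simp add: powr_minus_divide)
      also have "q powr (-3/2) = g m * g n"
        unfolding q_def g_def by (rule powr_mult)
      finally show ?thesis by (simp add: x)
    qed
  qed simp
  then show ?thesis
    unfolding L' using inj by (subst summable_on_reindex) (simp_all add: inj_on_def o_def)
qed

lemma finite_norm_le: "finite {w \<in> L. norm w \<le> R}"
proof (rule basis_obtain)
  fix w1 w2 and C :: real
  assume L: "L = {of_int m * w1 + of_int n * w2 |m n. True}" and C: "C > 0"
    and bd: "\<And>m n::int. \<bar>of_int m\<bar> + \<bar>of_int n\<bar> \<le> C * norm (of_int m * w1 + of_int n * w2)"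
  define N where "N = \<lceil>C * R\<rceil>"
  have "{w \<in> L. norm w \<le> R} \<subseteq> (\<lambda>(m, n). of_int m * w1 + of_int n * w2) ` ({-N..N} \<times> {-N..N})"
  proof
    fix w assume "w \<in> {w \<in> L. norm w \<le> R}"
    then obtain m n where w: "w = of_int m * w1 + of_int n * w2" "norm w \<le> R" unfolding L by blast
    have "\<bar>of_int m\<bar> + \<bar>of_int n\<bar> \<le> C * norm w" using bd[of m n] w(1) by simp
    also have "\<dots> \<le> C * R" using w(2) C by (intro mult_left_mono) auto
    finally have "\<bar>m\<bar> \<le> N" "\<bar>n\<bar> \<le> N" unfolding N_def by linarith+
    then show "w \<in> (\<lambda>(m, n). of_int m * w1 + of_int n * w2) ` ({-N..N} \<times> {-N..N})"
      using w(1) by (intro image_eqI[of _ _ "(m, n)"]) auto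
  qed
  then show ?thesis by (rule finite_subset) simp
qed

lemma not_islimpt: "\<not> x islimpt L"
proof
  assume "x islimpt L"
  then have "infinite (L \<inter> ball x 1)" by (simp add: islimpt_eq_infinite_ball)
  moreover have "L \<inter> ball x 1 \<subseteq> {w \<in> L. norm w \<le> norm x + 1}"
  proof
    fix w assume "w \<in> L \<inter> ball x 1"
    then show "w \<in> {w \<in> L. norm w \<le> norm x + 1}"
      using norm_triangle_sub[of w x] by (auto simp: dist_norm norm_minus_commute)
  qed
  ultimately show False using finite_norm_le finite_subset by blast
qed

text \<open>Stated for subsets because single lattice points are removed from \<open>L\<close> when
  the singularities are treated one at a time.\<close>

lemma closed_subset: "X \<subseteq> L \<Longrightarrow> closed X"
  unfolding closed_limpt using not_islimpt islimpt_subset by blast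

lemma countable: "countable L"
proof -
  have "L = (\<Union>n::nat. {w \<in> L. norm w \<le> real n})"
    using real_arch_simple by auto
  then show ?thesis
    using finite_norm_le countable_UN[of UNIV "\<lambda>n. {w \<in> L. norm w \<le> real n}"]
    by (simp add: countable_finite)
qed

text \<open>Subtract the integer parts of the real coordinates with respect to the basis. This
  provides the compact set on which a periodic entire function takes all its values.\<close>

lemma bounded_representatives: "\<exists>M. \<forall>z. \<exists>w\<in>L. norm (z - w) \<le> M"
proof (rule basis_obtain)
  fix w1 w2
  assume w: "w1 \<noteq> 0" "w2 / w1 \<notin> \<real>" and L: "L = {of_int m * w1 + of_int n * w2 |m n. True}"
  have "\<exists>w\<in>L. norm (z - w) \<le> norm w1 + norm w2" for z
  proof -
    define \<tau> where "\<tau> = w2 / w1"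
    have I: "Im \<tau> \<noteq> 0" using w(2) by (auto simp: \<tau>_def complex_is_Real_iff)
    define b where "b = Im (z / w1) / Im \<tau>"
    define a where "a = Re (z / w1) - b * Re \<tau>"
    have "z / w1 = of_real a + of_real b * \<tau>"
      using I by (simp add: complex_eq_iff a_def b_def)
    then have "z = (of_real a + of_real b * \<tau>) * w1" using w(1) by (simp add: divide_eq_eq)
    then have z: "z = of_real a * w1 + of_real b * w2"
      using w(1) by (simp add: \<tau>_def distrib_right)
    let ?w = "of_int \<lfloor>a\<rfloor> * w1 + of_int \<lfloor>b\<rfloor> * w2"
    have "z - ?w = of_real (frac a) * w1 + of_real (frac b) * w2"
      by (simp add: z frac_def algebra_simps)
    also have "norm \<dots> \<le> norm (of_real (frac a) * w1) + norm (of_real (frac b) * w2)"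
      by (rule norm_triangle_ineq)
    also have "\<dots> \<le> 1 * norm w1 + 1 * norm w2"
      unfolding norm_mult
      by (intro add_mono mult_right_mono) (simp_all add: less_imp_le[OF frac_lt_1])
    finally show ?thesis unfolding L by auto
  qed
  then show ?thesis by blast
qed

end

section \<open>The addition theorem\<close>

text \<open>A ball is uncountable, so every punctured neighbourhood of \<open>c\<close> contains
  points outside \<open>Z\<close>.\<close>

lemma limit_const_off_countable:
  fixes g :: "complex \<Rightarrow> complex"
  assumes g: "g \<midarrow>c\<rightarrow> l" and Z: "countable Z" and eq: "\<And>u. u \<notin> Z \<Longrightarrow> u \<noteq> c \<Longrightarrow> g u = K"
  shows "l = K"
proof (rule ccontr)
  assume "l \<noteq> K"
  then have "\<forall>\<^sub>F u in at c. g u \<noteq> K" by (rule tendsto_imp_eventually_ne[OF g])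
  then obtain d where d: "d > 0" "\<And>u. u \<noteq> c \<Longrightarrow> dist u c < d \<Longrightarrow> g u \<noteq> K"
    unfolding eventually_at by auto
  have "ball c d \<subseteq> insert c Z"
  proof
    fix u assume "u \<in> ball c d"
    then have "dist u c < d" by (simp add: dist_commute)
    then show "u \<in> insert c Z" using d(2)[of u] eq[of u] by blast
  qed
  then have "countable (ball c d)"
    by (rule countable_subset) (simp add: Z)
  then show False using uncountable_ball[OF d(1)] by blast
qed

text \<open>Periodicity is left out on purpose, so that the complex conjugate of a solution fits
  without any knowledge of its poles. The two limits at 0 fix the constant terms as well as the
  principal parts.\<close>

locale weierstrass_solution =
  fixes g2 g3 :: complex and A :: "complex set" and p p1 :: "complex \<Rightarrow> complex"
  assumes closed_poles: "closed A" and countable_poles: "countable A"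
    and deriv_p: "z \<notin> A \<Longrightarrow> (p has_field_derivative p1 z) (at z)"
    and deriv_p1: "z \<notin> A \<Longrightarrow> (p1 has_field_derivative 6 * p z ^ 2 - g2 / 2) (at z)"
    and curve: "z \<notin> A \<Longrightarrow> p1 z ^ 2 = 4 * p z ^ 3 - g2 * p z - g3"
    and pole: "(\<lambda>z. p z - 1 / z ^ 2) \<midarrow>0\<rightarrow> 0"
    and pole1: "(\<lambda>z. p1 z + 2 / z ^ 3) \<midarrow>0\<rightarrow> 0"
begin

lemma cont_p: "z \<notin> A \<Longrightarrow> isCont p z"
  by (rule DERIV_isCont[OF deriv_p])

lemma cont_p1: "z \<notin> A \<Longrightarrow> isCont p1 z"
  by (rule DERIV_isCont[OF deriv_p1])

lemma tendsto_pole_reflect: "(\<lambda>u. p (c - u) - 1 / (c - u) ^ 2) \<midarrow>c\<rightarrow> 0"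
proof (rule LIM_compose2[OF _ pole])
  show "(\<lambda>u. c - u) \<midarrow>c\<rightarrow> 0" by (auto intro!: tendsto_eq_intros)
qed (intro exI[of _ 1], auto)

lemma tendsto_pole1_reflect: "(\<lambda>u. p1 (c - u) + 2 / (c - u) ^ 3) \<midarrow>c\<rightarrow> 0"
proof (rule LIM_compose2[OF _ pole1])
  show "(\<lambda>u. c - u) \<midarrow>c\<rightarrow> 0" by (auto intro!: tendsto_eq_intros)
qed (intro exI[of _ 1], auto)

lemma deriv_reflect: "c - u \<notin> A \<Longrightarrow> ((\<lambda>u. p (c - u)) has_field_derivative - p1 (c - u)) (at u)"
proof -
  assume "c - u \<notin> A"
  moreover have "((\<lambda>u. c - u) has_field_derivative - 1) (at u)"
    by (auto intro!: derivative_eq_intros)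
  ultimately show ?thesis
    using DERIV_chain'[of "\<lambda>u. c - u" "- 1" u UNIV, OF _ deriv_p] by simp
qed

lemma deriv1_reflect:
  "c - u \<notin> A \<Longrightarrow> ((\<lambda>u. p1 (c - u)) has_field_derivative - (6 * p (c - u) ^ 2 - g2 / 2)) (at u)"
proof -
  assume "c - u \<notin> A"
  moreover have "((\<lambda>u. c - u) has_field_derivative - 1) (at u)"
    by (auto intro!: derivative_eq_intros)
  ultimately show ?thesis
    using DERIV_chain'[of "\<lambda>u. c - u" "- 1" u UNIV, OF _ deriv_p1] by simp
qed

end

text \<open>Here w = c - u, while e0 + 1/w^2 and e1 - 2/w^3 stand for the values of \<open>q\<close>
  and its derivative at \<open>w\<close>. On the right the poles have cancelled: for w and e0
  tending to 0 and bounded \<open>n\<close>, it tends to 2m - P, which is the limit of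
  \<open>P\<close>.\<close>

lemma chord_expansion:
  fixes w P P1 e0 e1 :: complex
  defines "m \<equiv> P - e0" and "n \<equiv> P1 - e1"
  assumes w: "w \<noteq> 0" and M: "1 - w ^ 2 * m \<noteq> 0"
  shows "((P1 - (e1 - 2 / w ^ 3)) / (P - (e0 + 1 / w ^ 2))) ^ 2 / 4 - P - (e0 + 1 / w ^ 2)
    = (w * n + w ^ 4 * n ^ 2 / 4 + 2 * m - w ^ 2 * m ^ 2) / (1 - w ^ 2 * m) ^ 2 - P - e0"
proof -
  define M where "M = 1 - w ^ 2 * m"
  have M0: "M \<noteq> 0" using M by (simp add: M_def)
  have D: "P - (e0 + 1 / w ^ 2) = - M / w ^ 2"
    using w by (simp add: M_def m_def field_simps)
  have N: "P1 - (e1 - 2 / w ^ 3) = (2 + w ^ 3 * n) / w ^ 3"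
    using w by (simp add: n_def field_simps)
  have "(P1 - (e1 - 2 / w ^ 3)) / (P - (e0 + 1 / w ^ 2)) = - ((2 + w ^ 3 * n) / (w * M))"
    unfolding D N using w M0 by (simp add: divide_simps power2_eq_square power3_eq_cube)
  then have "((P1 - (e1 - 2 / w ^ 3)) / (P - (e0 + 1 / w ^ 2))) ^ 2 / 4 - 1 / w ^ 2
      = ((2 + w ^ 3 * n) / (w * M)) ^ 2 / 4 - 1 / w ^ 2" by simp
  also have "\<dots> = ((2 + w ^ 3 * n) ^ 2 / 4 - M ^ 2) / (w ^ 2 * M ^ 2)"
    using w M0 by (simp add: power_divide power_mult_distrib divide_simps)
  finally have 1: "((P1 - (e1 - 2 / w ^ 3)) / (P - (e0 + 1 / w ^ 2))) ^ 2 / 4 - 1 / w ^ 2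
      = ((2 + w ^ 3 * n) ^ 2 / 4 - M ^ 2) / (w ^ 2 * M ^ 2)" .
  have "(2 + w ^ 3 * n) ^ 2 / 4 - M ^ 2 = w ^ 2 * (w * n + w ^ 4 * n ^ 2 / 4 + 2 * m - w ^ 2 * m ^ 2)"
    unfolding M_def by (simp add: field_simps power2_eq_square power3_eq_cube power4_eq_xxxx)
  then have "((P1 - (e1 - 2 / w ^ 3)) / (P - (e0 + 1 / w ^ 2))) ^ 2 / 4 - 1 / w ^ 2
      = (w * n + w ^ 4 * n ^ 2 / 4 + 2 * m - w ^ 2 * m ^ 2) / M ^ 2"
    unfolding 1 using w by simp
  then show ?thesis unfolding M_def by (simp add: algebra_simps)
qed

text \<open>The left side is the numerator of the derivative of the chord slope along
  \<open>u + w = c\<close>. So the slope has derivative 2(p - q), and a quarter of its square has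
  derivative p1 - q1, which cancels that of - p - q.\<close>

lemma chord_derivative_algebra:
  fixes p p1 q q1 g2 g3 :: complex
  assumes "p1 ^ 2 = 4 * p ^ 3 - g2 * p - g3" "q1 ^ 2 = 4 * q ^ 3 - g2 * q - g3"
  shows "(p - q) * ((6 * p ^ 2 - g2 / 2) + (6 * q ^ 2 - g2 / 2)) - (p1 - q1) * (p1 + q1) = 2 * (p - q) ^ 3"
proof -
  have "(p1 - q1) * (p1 + q1) = p1 ^ 2 - q1 ^ 2" by (simp add: algebra_simps power2_eq_square)
  also have "\<dots> = 4 * p ^ 3 - g2 * p - g3 - (4 * q ^ 3 - g2 * q - g3)" using assms by simp
  finally have e: "(p1 - q1) * (p1 + q1) = 4 * p ^ 3 - g2 * p - g3 - (4 * q ^ 3 - g2 * q - g3)" .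
  show ?thesis unfolding e by (simp add: algebra_simps power2_eq_square power3_eq_cube)
qed

text \<open>
  Euler's argument: along \<open>u + w = c\<close> the differential equations make the derivative of
  the chord expression vanish, so that it equals its limit for \<open>u \<rightarrow> c\<close>. Nothing
  forces the two functions to be the same, and comparing the limits for \<open>u \<rightarrow> c\<close> and
  \<open>u \<rightarrow> 0\<close> shows afterwards that they are.
\<close>

lemma euler_addition:
  assumes "weierstrass_solution g2 g3 A p p1" "weierstrass_solution g2 g3 B q q1"
    and c: "c \<notin> A"
  shows "countable {u. u \<in> A \<or> c - u \<in> B \<or> p u = q (c - u)}" (is "countable ?Z")
    and "\<And>u. u \<notin> A \<Longrightarrow> c - u \<notin> B \<Longrightarrow> p u \<noteq> q (c - u) \<Longrightarrow>
      ((p1 u - q1 (c - u)) / (p u - q (c - u))) ^ 2 / 4 - p u - q (c - u) = p c"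
proof -
  interpret P: weierstrass_solution g2 g3 A p p1 by fact
  interpret Q: weierstrass_solution g2 g3 B q q1 by fact
  define e0 where "e0 = (\<lambda>u. q (c - u) - 1 / (c - u) ^ 2)"
  define e1 where "e1 = (\<lambda>u. q1 (c - u) + 2 / (c - u) ^ 3)"
  have e0: "e0 \<midarrow>c\<rightarrow> 0" unfolding e0_def by (rule Q.tendsto_pole_reflect)
  have e1: "e1 \<midarrow>c\<rightarrow> 0" unfolding e1_def by (rule Q.tendsto_pole1_reflect)
  have pc: "p \<midarrow>c\<rightarrow> p c" using P.cont_p[OF c] by (simp add: isCont_def)
  have p1c: "p1 \<midarrow>c\<rightarrow> p1 c" using P.cont_p1[OF c] by (simp add: isCont_def)
  \<comment> \<open>For \<open>u\<close> different from \<open>c\<close>, \<open>M u\<close> is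
    \<open>p u - q (c - u)\<close> times \<open>- (c - u) ^ 2\<close>: clearing the double pole
    leaves the limit 1.\<close>
  define M where "M = (\<lambda>u. 1 - (c - u) ^ 2 * (p u - e0 u))"
  have M: "M \<midarrow>c\<rightarrow> 1"
    unfolding M_def by (rule tendsto_eq_intros pc e0 refl)+ simp
  define U where "U = - (A \<union> (\<lambda>b. c - b) ` B)"
  have U_iff: "u \<in> U \<longleftrightarrow> u \<notin> A \<and> c - u \<notin> B" for u
    unfolding U_def by (auto intro: image_eqI[of _ _ "c - u"])
  have cU: "countable (- U)"
    unfolding U_def using P.countable_poles Q.countable_poles by simp
  have "closed ((\<lambda>b. c - b) ` B)"
    using closed_injective_linear_image[OF Q.closed_poles, of uminus]
    closed_translation[of "uminus ` B" c]
    by (simp add: image_image linear_uminus)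
  then have oU: "open U"
    unfolding U_def by (intro open_Compl closed_Un P.closed_poles)
  have conU: "connected U"
    using path_connected_complement_countable[OF _ cU] path_connected_imp_connected by simp
  define f where "f = (\<lambda>u. p u - q (c - u))"
  have df: "(f has_field_derivative p1 u + q1 (c - u)) (at u)" if "u \<in> U" for u
    using that unfolding f_def U_iff
    by (auto intro!: derivative_eq_intros P.deriv_p Q.deriv_reflect)
  have hol: "f holomorphic_on U"
    using df oU holomorphic_on_open by blast
  have fM: "f u * (c - u) ^ 2 = - M u" if "u \<noteq> c" for u
    using that by (simp add: f_def M_def e0_def field_simps)
  \<comment> \<open>If \<open>f\<close> were constant, \<open>f u * (c - u) ^ 2\<close> would tend
    to 0 at \<open>c\<close>, but it tends to -1.\<close>
  have nc: "\<not> f constant_on U"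
  proof
    assume "f constant_on U"
    then obtain K where K: "\<And>u. u \<in> U \<Longrightarrow> f u = K" by (auto simp: constant_on_def)
    have "(\<lambda>u. - M u - K * (c - u) ^ 2) \<midarrow>c\<rightarrow> - 1"
      by (rule tendsto_eq_intros M refl)+ simp
    then have "- 1 = (0::complex)"
    proof (rule limit_const_off_countable[OF _ cU])
      fix u assume "u \<notin> - U" "u \<noteq> c"
      then show "- M u - K * (c - u) ^ 2 = 0" using K[of u] fM[of u] by simp
    qed
    then show False by simp
  qed
  \<comment> \<open>The countability of the zeros of a holomorphic function is available on F-sigma
    domains.\<close>
  have "fsigma U"
  proof (rule open_Union_compact_subsets[OF oU])
    fix C :: "nat \<Rightarrow> complex set" assume C: "\<And>n. compact (C n)" "\<Union> (range C) = U"
    show ?thesis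
      unfolding fsigma_Union_compact
    proof (intro exI[of _ C] conjI)
      show "range C \<subseteq> Collect compact" using C(1) by auto
      show "U = \<Union> (range C)" using C(2) by simp
    qed
  qed
  then have "countable {u\<in>U. f u = 0}"
    using holomorphic_countable_zeros[OF hol oU conU _ nc] by blast
  moreover have Z: "?Z = - U \<union> {u\<in>U. f u = 0}"
    using U_iff by (auto simp: f_def)
  ultimately show cZ: "countable ?Z" using cU by simp
  \<comment> \<open>\<open>S\<close> is the complement of a countable set, hence connected, so a
    vanishing derivative gives a single constant on all of it.\<close>
  define S where "S = {u\<in>U. f u \<noteq> 0}"
  have S: "S = - ?Z" unfolding Z S_def by blast
  have conS: "connected S"
    unfolding S using path_connected_complement_countable[OF _ cZ] path_connected_imp_connected by simp
  have "S = U \<inter> f -` (- {0})" unfolding S_def by blast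
  then have oS: "open S"
    using continuous_open_preimage[OF holomorphic_on_imp_continuous_on[OF hol] oU, of "- {0}"]
    by (simp add: open_Compl)
  define F where "F = (\<lambda>u. ((p1 u - q1 (c - u)) / f u) ^ 2 / 4 - p u - q (c - u))"
  have dF: "(F has_field_derivative 0) (at u)" if "u \<in> S" for u
  proof -
    have f0: "f u \<noteq> 0" and uU: "u \<in> U"
      using that unfolding S_def by simp_all
    then have u: "u \<notin> A" "c - u \<notin> B" unfolding U_iff by simp_all
    define N where "N = p1 u - q1 (c - u)"
    define N' where "N' = (6 * p u ^ 2 - g2 / 2) + (6 * q (c - u) ^ 2 - g2 / 2)"
    define D where "D = f u"
    define D' where "D' = p1 u + q1 (c - u)"
    have "((\<lambda>u. p1 u - q1 (c - u)) has_field_derivative N') (at u)"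
      unfolding N'_def
      by (rule DERIV_cong[OF DERIV_diff[OF P.deriv_p1[OF u(1)] Q.deriv1_reflect[OF u(2)]]]) simp
    from DERIV_divide[OF this df[OF uU] f0]
    have "((\<lambda>u. (p1 u - q1 (c - u)) / f u) has_field_derivative (N' * D - N * D') / (D * D)) (at u)"
      unfolding N_def D_def D'_def .
    from DERIV_power[OF this, of 2]
    have "((\<lambda>u. ((p1 u - q1 (c - u)) / f u) ^ 2 / 4) has_field_derivative
        2 * ((N' * D - N * D') / (D * D) * (N / D)) / 4) (at u)"
      by (intro DERIV_cdivide, rule DERIV_cong) (simp add: N_def D_def)
    then have "(F has_field_derivative
        2 * ((N' * D - N * D') / (D * D) * (N / D)) / 4 - p1 u - (- q1 (c - u))) (at u)"
      unfolding F_def by (intro DERIV_diff P.deriv_p Q.deriv_reflect u)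
    moreover have "N' * D - N * D' = 2 * D ^ 3"
      using chord_derivative_algebra[OF P.curve[OF u(1)] Q.curve[OF u(2)]]
      unfolding N_def N'_def D_def D'_def f_def by (simp only: mult.commute)
    moreover have "2 * (2 * D ^ 3 / (D * D) * (N / D)) / 4 = N"
      using f0 by (simp add: D_def power3_eq_cube)
    ultimately have "(F has_field_derivative N - p1 u - (- q1 (c - u))) (at u)" by simp
    then show ?thesis unfolding N_def by simp
  qed
  have "\<exists>K. \<forall>u\<in>S. F u = K"
  proof -
    have "F constant_on S"
      by (rule has_field_derivative_0_imp_constant_on[OF dF conS oS])
    then show ?thesis unfolding constant_on_def .
  qed
  then obtain K where K: "\<And>u. u \<in> S \<Longrightarrow> F u = K" by blast
  \<comment> \<open>In the notation of \<open>chord_expansion\<close>, \<open>H\<close> is the chord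
    expression with its pole at \<open>c\<close> cancelled, so that its limit can be read
    off.\<close>
  define m where "m = (\<lambda>u. p u - e0 u)"
  define n where "n = (\<lambda>u. p1 u - e1 u)"
  define H where "H = (\<lambda>u. ((c - u) * n u + (c - u) ^ 4 * n u ^ 2 / 4 + 2 * m u - (c - u) ^ 2 * m u ^ 2)
      / (M u) ^ 2 - p u - e0 u)"
  have m: "m \<midarrow>c\<rightarrow> p c" unfolding m_def by (rule tendsto_eq_intros pc e0 refl)+ simp
  have n: "n \<midarrow>c\<rightarrow> p1 c" unfolding n_def by (rule tendsto_eq_intros p1c e1 refl)+ simp
  have "H \<midarrow>c\<rightarrow> ((c - c) * p1 c + (c - c) ^ 4 * p1 c ^ 2 / 4 + 2 * p c - (c - c) ^ 2 * p c ^ 2) / 1 ^ 2 - p c - 0"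
    unfolding H_def by (intro tendsto_intros m n pc e0 M) auto
  then have H: "H \<midarrow>c\<rightarrow> p c" by simp
  have "p c = K"
  proof (rule limit_const_off_countable[OF H cZ])
    fix u assume u: "u \<notin> ?Z" "u \<noteq> c"
    then have uS: "u \<in> S" unfolding S by blast
    have M0: "M u \<noteq> 0" using fM[of u] u uS by (auto simp: S_def)
    have q: "q (c - u) = e0 u + 1 / (c - u) ^ 2" and q1: "q1 (c - u) = e1 u - 2 / (c - u) ^ 3"
      by (simp_all add: e0_def e1_def)
    have "F u = H u"
      unfolding F_def f_def H_def M_def m_def n_def q q1
      by (rule chord_expansion) (use u M0 in \<open>auto simp: M_def\<close>)
    then show "H u = K" using K[OF uS] by simp
  qed
  then show "((p1 u - q1 (c - u)) / (p u - q (c - u))) ^ 2 / 4 - p u - q (c - u) = p c"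
    if "u \<notin> A" "c - u \<notin> B" "p u \<noteq> q (c - u)" for u
    using K[of u] that by (simp add: S_def F_def f_def U_iff)
qed

text \<open>Interchanging the two solutions together with \<open>u\<close> and \<open>c - u\<close>
  leaves the chord expression unchanged. A point \<open>u\<close> at which it is defined exists
  because the exceptional set is countable.\<close>

lemma weierstrass_solution_unique:
  assumes P: "weierstrass_solution g2 g3 A p p1" and Q: "weierstrass_solution g2 g3 B q q1"
    and c: "c \<notin> A" "c \<notin> B"
  shows "p c = q c"
proof -
  let ?Z = "{u. u \<in> A \<or> c - u \<in> B \<or> p u = q (c - u)}"
  have "?Z \<noteq> UNIV"
    using euler_addition(1)[OF P Q c(1)] uncountable_UNIV_complex by auto
  then obtain u where u: "u \<notin> A" "c - u \<notin> B" "p u \<noteq> q (c - u)" by blast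
  have "((p1 u - q1 (c - u)) / (p u - q (c - u))) ^ 2 / 4 - p u - q (c - u) = p c"
    by (rule euler_addition(2)[OF P Q c(1) u])
  moreover have "((q1 (c - u) - p1 (c - (c - u))) / (q (c - u) - p (c - (c - u)))) ^ 2 / 4
      - q (c - u) - p (c - (c - u)) = q c"
    by (rule euler_addition(2)[OF Q P c(2)]) (use u in auto)
  then have "((q1 (c - u) - p1 u) / (q (c - u) - p u)) ^ 2 / 4 - q (c - u) - p u = q c"
    by simp
  moreover have "(q1 (c - u) - p1 u) / (q (c - u) - p u) = (p1 u - q1 (c - u)) / (p u - q (c - u))"
    by (metis minus_diff_eq minus_divide_divide)
  ultimately show ?thesis by (simp add: algebra_simps)
qed

section \<open>Addition and duplication formulas for a single solution\<close>

context weierstrass_solution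
begin

text \<open>Both sides are continuous in \<open>u\<close>, so the identity extends over the
  countably many points at which the chord has equal abscissae.\<close>

lemma addition_cleared:
  assumes c: "c \<notin> A" and u: "u \<notin> A" "c - u \<notin> A"
  shows "4 * (p c + p u + p (c - u)) * (p u - p (c - u)) ^ 2 = (p1 u - p1 (c - u)) ^ 2"
proof -
  note sol = weierstrass_solution_axioms
  let ?G = "\<lambda>u. 4 * (p c + p u + p (c - u)) * (p u - p (c - u)) ^ 2 - (p1 u - p1 (c - u)) ^ 2"
  let ?Z = "{u. u \<in> A \<or> c - u \<in> A \<or> p u = p (c - u)}"
  have "isCont ?G u"
    by (intro continuous_intros cont_p cont_p1 u
      DERIV_isCont[OF deriv_reflect] DERIV_isCont[OF deriv1_reflect])
  then have "?G \<midarrow>u\<rightarrow> ?G u" by (simp only: isCont_def)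
  then have "?G u = 0"
  proof (rule limit_const_off_countable)
    show "countable ?Z" by (rule euler_addition(1)[OF sol sol c])
    fix v assume v: "v \<notin> ?Z"
    then have d: "p v - p (c - v) \<noteq> 0" by simp
    define X where "X = ((p1 v - p1 (c - v)) / (p v - p (c - v))) ^ 2"
    have "X / 4 - p v - p (c - v) = p c"
      unfolding X_def by (rule euler_addition(2)[OF sol sol c]) (use v in auto)
    then have "4 * (p c + p v + p (c - v)) = X" by (simp add: field_simps)
    then have "4 * (p c + p v + p (c - v)) = ((p1 v - p1 (c - v)) / (p v - p (c - v))) ^ 2"
      by (simp only: X_def)
    then show "?G v = 0" using d by (simp add: power_divide)
  qed
  then show ?thesis by simp
qed

lemma addition_x:
  assumes "u \<notin> A" "w \<notin> A" "u + w \<notin> A" "p u \<noteq> p w"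
  shows "p (u + w) = ((p1 u - p1 w) / (p u - p w)) ^ 2 / 4 - p u - p w"
proof -
  have "4 * (p (u + w) + p u + p w) * (p u - p w) ^ 2 = (p1 u - p1 w) ^ 2"
    using addition_cleared[of "u + w" u] assms by simp
  then have "4 * (p (u + w) + p u + p w) = ((p1 u - p1 w) / (p u - p w)) ^ 2"
    using assms(4) by (simp add: power_divide eq_divide_eq)
  then have "p (u + w) + p u + p w = ((p1 u - p1 w) / (p u - p w)) ^ 2 / 4"
    by (metis nonzero_mult_div_cancel_left zero_neq_numeral)
  then show ?thesis by (simp add: algebra_simps)
qed

lemma open_regular: "open {u. u \<notin> A \<and> u + w \<notin> A}"
proof -
  have "{u. u \<notin> A \<and> u + w \<notin> A} = - A \<inter> (\<lambda>u. u + w) -` (- A)" by auto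
  then show ?thesis
    using closed_poles by (auto intro!: open_Int open_vimage continuous_intros simp: open_Compl)
qed

lemma deriv_shift: "u + w \<notin> A \<Longrightarrow> ((\<lambda>u. p (u + w)) has_field_derivative p1 (u + w)) (at u)"
  by (rule DERIV_shift[THEN iffD1, OF deriv_p])

lemma deriv1_shift:
  "u + w \<notin> A \<Longrightarrow> ((\<lambda>u. p1 (u + w)) has_field_derivative 6 * p (u + w) ^ 2 - g2 / 2) (at u)"
  by (rule DERIV_shift[THEN iffD1, OF deriv_p1])

text \<open>Differentiating the cleared identity in \<open>u\<close> with \<open>w\<close> fixed
  expresses \<open>p1 (u + w)\<close> through the second derivative at \<open>u\<close>. The curve
  equations at \<open>u\<close> and \<open>w\<close> then turn this into the equation of the
  chord.\<close>

lemma addition_y: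
  assumes u: "u \<notin> A" and w: "w \<notin> A" and uw: "u + w \<notin> A" and ne: "p u \<noteq> p w"
  defines "l \<equiv> (p1 u - p1 w) / (p u - p w)"
  shows "p1 (u + w) = l * (p u - p (u + w)) - p1 u"
proof -
  define d where "d = p u - p w"
  define p2 where "p2 = 6 * p u ^ 2 - g2 / 2"
  define X where "X = p (u + w) + p u + p w"
  have d0: "d \<noteq> 0" using ne by (simp add: d_def)
  have n: "p1 u - p1 w = l * d" using d0 by (simp add: l_def d_def)
  let ?l = "\<lambda>v. 4 * (p (v + w) + p v + p w) * (p v - p w) ^ 2"
  let ?r = "\<lambda>v. (p1 v - p1 w) ^ 2"
  have "(?l has_field_derivative 4 * (p1 (u + w) + p1 u) * d ^ 2 + 4 * X * (2 * d * p1 u)) (at u)"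
    using u w uw unfolding d_def X_def
    by (auto intro!: derivative_eq_intros deriv_p deriv_shift simp: algebra_simps)
  then have "(?r has_field_derivative 4 * (p1 (u + w) + p1 u) * d ^ 2 + 4 * X * (2 * d * p1 u)) (at u)"
  proof (rule has_field_derivative_transform_within_open[OF _ open_regular])
    show "u \<in> {u. u \<notin> A \<and> u + w \<notin> A}" using u uw by simp
    show "?l v = ?r v" if "v \<in> {u. u \<notin> A \<and> u + w \<notin> A}" for v
      using addition_cleared[of "v + w" v] that w by simp
  qed
  moreover have "(?r has_field_derivative 2 * (l * d) * p2) (at u)"
    unfolding n[symmetric] p2_def using u
    by (auto intro!: derivative_eq_intros deriv_p1)
  ultimately have e1: "4 * (p1 (u + w) + p1 u) * d ^ 2 + 4 * X * (2 * d * p1 u) = 2 * (l * d) * p2"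
    by (rule DERIV_unique)
  have X: "X = l ^ 2 / 4"
    using addition_x[OF u w uw ne] by (simp add: X_def l_def)
  have "2 * d * (2 * (p1 (u + w) + p1 u) * d + l ^ 2 * p1 u - l * p2) = 0"
    using e1 unfolding X by (simp add: algebra_simps power2_eq_square)
  then have e2: "2 * (p1 (u + w) + p1 u) * d + l ^ 2 * p1 u = l * p2" using d0 by simp
  \<comment> \<open>The difference of the two curve equations, divided by \<open>d\<close>, relates
    the slope to the sum of the ordinates.\<close>
  have "(p1 u - p1 w) * (p1 u + p1 w) = p1 u ^ 2 - p1 w ^ 2"
    by (simp add: algebra_simps power2_eq_square)
  also have "\<dots> = d * (4 * (p u ^ 2 + p u * p w + p w ^ 2) - g2)"
    unfolding curve[OF u] curve[OF w] d_def
    by (simp add: algebra_simps power2_eq_square power3_eq_cube)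
  finally have "d * (l * (p1 u + p1 w) - (4 * (p u ^ 2 + p u * p w + p w ^ 2) - g2)) = 0"
    unfolding n by (simp add: algebra_simps)
  then have e3: "l * (p1 u + p1 w) = 4 * (p u ^ 2 + p u * p w + p w ^ 2) - g2"
    using d0 by simp
  have pw1: "p1 w = p1 u - l * d" using n by (simp add: algebra_simps)
  have pw: "p w = p u - d" by (simp add: d_def)
  have pX: "p (u + w) = l ^ 2 / 4 - p u - p w" using X by (simp add: X_def algebra_simps)
  have "2 * d * (p1 (u + w) + p1 u - l * (p u - p (u + w))) = 0"
  proof -
    have "2 * d * (p1 (u + w) + p1 u - l * (p u - p (u + w)))
        = l * (p2 - l * p1 u - 2 * d * (p u - p (u + w)))"
      using e2 by (simp add: algebra_simps power2_eq_square)
    also have "p2 - l * p1 u - 2 * d * (p u - p (u + w)) = 0"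
    proof -
      have "4 * (p2 - l * p1 u - 2 * d * (p u - p (u + w)))
          = 2 * (4 * (p u ^ 2 + p u * p w + p w ^ 2) - g2 - l * (p1 u + p1 w))"
        unfolding pX p2_def pw pw1 by (simp add: algebra_simps power2_eq_square)
      also have "\<dots> = 0" unfolding e3 by simp
      finally show ?thesis by (simp only: mult_eq_0_iff) simp
    qed
    finally show ?thesis by simp
  qed
  then have "p1 (u + w) + p1 u - l * (p u - p (u + w)) = 0"
    using d0 by (simp only: mult_eq_0_iff) simp
  then show ?thesis by (simp add: algebra_simps)
qed

lemma quotient_limit: "w \<notin> A \<Longrightarrow> (\<lambda>u. (p u - p w) / (u - w)) \<midarrow>w\<rightarrow> p1 w"
  using deriv_p[of w] by (simp add: has_field_derivative_iff)

lemma quotient_limit1: "w \<notin> A \<Longrightarrow> (\<lambda>u. (p1 u - p1 w) / (u - w)) \<midarrow>w\<rightarrow> 6 * p w ^ 2 - g2 / 2"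
  using deriv_p1[of w] by (simp add: has_field_derivative_iff)

lemma eventually_regular:
  assumes "w \<notin> A" "2 * w \<notin> A"
  shows "\<forall>\<^sub>F u in at w. u \<notin> A \<and> u + w \<notin> A"
proof -
  have w: "w \<in> {u. u \<notin> A \<and> u + w \<notin> A}" using assms unfolding mult_2 by blast
  show ?thesis
    unfolding eventually_at_topological
    by (rule exI[of _ "{u. u \<notin> A \<and> u + w \<notin> A}"], intro conjI open_regular w) blast
qed

lemma tendsto_double: "2 * w \<notin> A \<Longrightarrow> (\<lambda>u. p (u + w)) \<midarrow>w\<rightarrow> p (2 * w)"
  using DERIV_isCont[OF deriv_shift[of w w]] unfolding isCont_def mult_2 .

lemma tendsto_double1: "2 * w \<notin> A \<Longrightarrow> (\<lambda>u. p1 (u + w)) \<midarrow>w\<rightarrow> p1 (2 * w)"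
  using DERIV_isCont[OF deriv1_shift[of w w]] unfolding isCont_def mult_2 .

text \<open>The cleared addition theorem divided by (u - w)^2 has this limit for \<open>u\<close>
  tending to \<open>w\<close>. It also holds where \<open>p1 w = 0\<close>, which is the case that
  \<open>deriv_wp_nonzero\<close> exploits.\<close>

lemma duplication_cleared:
  assumes w: "w \<notin> A" "2 * w \<notin> A"
  shows "4 * (p (2 * w) + 2 * p w) * p1 w ^ 2 = (6 * p w ^ 2 - g2 / 2) ^ 2"
proof -
  let ?G = "\<lambda>u. 4 * (p (u + w) + p u + p w) * ((p u - p w) / (u - w)) ^ 2 - ((p1 u - p1 w) / (u - w)) ^ 2"
  have pw: "p \<midarrow>w\<rightarrow> p w" using cont_p[OF w(1)] by (simp add: isCont_def)
  have "?G \<midarrow>w\<rightarrow> 4 * (p (2 * w) + p w + p w) * p1 w ^ 2 - (6 * p w ^ 2 - g2 / 2) ^ 2"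
    by (intro tendsto_intros tendsto_double w pw quotient_limit quotient_limit1)
  moreover have "\<forall>\<^sub>F u in at w. ?G u = 0"
    using eventually_regular[OF w] eventually_neq_at_within[of w]
  proof eventually_elim
    case (elim u)
    then have "4 * (p (u + w) + p u + p w) * (p u - p w) ^ 2 = (p1 u - p1 w) ^ 2"
      using addition_cleared[of "u + w" u] w by simp
    then have "4 * (p (u + w) + p u + p w) * (p u - p w) ^ 2 / (u - w) ^ 2 = (p1 u - p1 w) ^ 2 / (u - w) ^ 2"
      by simp
    then show ?case by (simp add: power_divide)
  qed
  then have "?G \<midarrow>w\<rightarrow> 0" by (rule tendsto_eventually)
  ultimately have "4 * (p (2 * w) + p w + p w) * p1 w ^ 2 - (6 * p w ^ 2 - g2 / 2) ^ 2 = 0"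
    by (rule LIM_unique)
  then show ?thesis by (simp add: algebra_simps)
qed

lemma duplication_x:
  assumes "w \<notin> A" "2 * w \<notin> A" "p1 w \<noteq> 0"
  shows "p (2 * w) = ((6 * p w ^ 2 - g2 / 2) / p1 w) ^ 2 / 4 - 2 * p w"
proof -
  define a where "a = 6 * p w ^ 2 - g2 / 2"
  have "4 * (p (2 * w) + 2 * p w) * p1 w ^ 2 = a ^ 2"
    using duplication_cleared[OF assms(1,2)] by (simp only: a_def)
  then have "4 * (p (2 * w) + 2 * p w) = (a / p1 w) ^ 2"
    using assms(3) by (simp add: power_divide eq_divide_eq)
  moreover have "x = Z / 4 - 2 * y" if "4 * (x + 2 * y) = Z" for x y Z :: complex
    using that by (simp add: field_simps)
  ultimately have "p (2 * w) = (a / p1 w) ^ 2 / 4 - 2 * p w" by blast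
  then show ?thesis by (simp only: a_def)
qed

text \<open>The chord slope is a quotient of two difference quotients and tends to the tangent
  slope.\<close>

lemma duplication_y:
  assumes w: "w \<notin> A" "2 * w \<notin> A" and p1w: "p1 w \<noteq> 0"
  shows "p1 (2 * w) = (6 * p w ^ 2 - g2 / 2) / p1 w * (p w - p (2 * w)) - p1 w"
proof -
  let ?q = "\<lambda>u. (p u - p w) / (u - w)" and ?q1 = "\<lambda>u. (p1 u - p1 w) / (u - w)"
  let ?G = "\<lambda>u. ?q1 u / ?q u * (p u - p (u + w)) - p1 u"
  have pw: "p \<midarrow>w\<rightarrow> p w" "p1 \<midarrow>w\<rightarrow> p1 w"
    using cont_p[OF w(1)] cont_p1[OF w(1)] by (simp_all add: isCont_def)
  have "?G \<midarrow>w\<rightarrow> (6 * p w ^ 2 - g2 / 2) / p1 w * (p w - p (2 * w)) - p1 w"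
    by (intro tendsto_diff tendsto_mult tendsto_divide[OF quotient_limit1 quotient_limit]
      tendsto_double w pw p1w)
  moreover have "\<forall>\<^sub>F u in at w. ?G u = p1 (u + w)"
    using eventually_regular[OF w] eventually_neq_at_within[of w]
      tendsto_imp_eventually_ne[OF quotient_limit[OF w(1)] p1w]
  proof eventually_elim
    case (elim u)
    have "?q1 u / ?q u = (p1 u - p1 w) / (p u - p w)" using elim by simp
    moreover have "p u \<noteq> p w" using elim by auto
    ultimately show ?case using addition_y[of u w] elim w by simp
  qed
  ultimately have "(\<lambda>u. p1 (u + w)) \<midarrow>w\<rightarrow> (6 * p w ^ 2 - g2 / 2) / p1 w * (p w - p (2 * w)) - p1 w"
    by (rule Lim_transform_eventually)
  with tendsto_double1[OF w(2)] show ?thesis by (rule LIM_unique)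
qed

end

section \<open>The Weierstrass function\<close>

definition wp_term :: "complex \<Rightarrow> complex \<Rightarrow> complex" where
  "wp_term w z = 1 / (z - w) ^ 2 - 1 / w ^ 2"

text \<open>Over a common denominator the numerator is z(2w - z). The factor 10 comes from |2w - z|
  being at most 5/2 |w| and |z - w| at least |w|/2.\<close>

lemma norm_wp_term_le:
  assumes "norm z \<le> R" "2 * R \<le> norm w" "0 < R"
  shows "norm (wp_term w z) \<le> 10 * R * (1 / norm w ^ 3)"
proof -
  define a where "a = norm w"
  have a: "a > 0" using assms unfolding a_def by linarith
  have d: "a / 2 \<le> norm (z - w)"
    using norm_triangle_sub[of w z] assms by (simp add: a_def norm_minus_commute)
  have e: "norm (2 * w - z) \<le> 5 / 2 * a"
    using norm_triangle_ineq4[of "2 * w" z] assms by (simp add: a_def norm_mult)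
  have "w \<noteq> 0" "z - w \<noteq> 0" using a d by (auto simp: a_def)
  then have "wp_term w z = z * (2 * w - z) / ((z - w) ^ 2 * w ^ 2)"
    unfolding wp_term_def by (simp add: diff_frac_eq) (simp add: power2_eq_square algebra_simps)
  then have "norm (wp_term w z) = norm z * norm (2 * w - z) / (norm (z - w) ^ 2 * a ^ 2)"
    by (simp add: norm_mult norm_divide norm_power a_def)
  also have "\<dots> \<le> R * (5 / 2 * a) / ((a / 2) ^ 2 * a ^ 2)"
    using a d e assms by (intro frac_le mult_mono power_mono mult_pos_pos) auto
  also have "\<dots> = 10 * R * (1 / a ^ 3)"
    using a by (simp add: field_simps power2_eq_square power3_eq_cube)
  finally show ?thesis by (simp add: a_def)
qed

lemma holomorphic_on_wp_term: "w \<notin> A \<Longrightarrow> wp_term w holomorphic_on A"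
  unfolding wp_term_def by (intro holomorphic_intros) auto

lemma DERIV_divide_power:
  fixes z w c :: complex
  assumes "z \<noteq> w"
  shows "((\<lambda>z. c / (z - w) ^ Suc n) has_field_derivative - (of_nat (Suc n) * c) / (z - w) ^ Suc (Suc n)) (at z)"
proof -
  define y where "y = inverse (z - w)"
  have "((\<lambda>z. z - w) has_field_derivative 1) (at z)"
    by (auto intro!: derivative_eq_intros)
  then have "((\<lambda>z. inverse (z - w)) has_field_derivative - (y * 1 * y)) (at z)"
    unfolding y_def by (rule DERIV_inverse') (use assms in simp)
  from DERIV_cmult[OF DERIV_power_Suc[OF this, of n], of c]
  have "((\<lambda>z. c * inverse (z - w) ^ Suc n) has_field_derivative
      c * ((1 + of_nat n) * (- (y * 1 * y) * y ^ n))) (at z)"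
    by (simp only: y_def)
  moreover have "c * ((1 + of_nat n) * (- (y * 1 * y) * y ^ n)) = - (of_nat (Suc n) * c) * y ^ Suc (Suc n)"
    by (simp add: algebra_simps)
  ultimately show ?thesis by (simp only: y_def divide_inverse power_inverse)
qed

text \<open>Only derivatives of positive order appear, where the constant \<open>1 / w ^ 2\<close>
  has dropped out.\<close>

lemma higher_deriv_wp_term:
  "z \<noteq> w \<Longrightarrow> (deriv ^^ Suc m) (wp_term w) z = (- 1) ^ Suc m * fact (m + 2) / (z - w) ^ (m + 3)"
proof (induction m arbitrary: z)
  case 0
  have "(wp_term w has_field_derivative - (of_nat (Suc 1) * 1) / (z - w) ^ Suc (Suc 1) - 0) (at z)"
    unfolding wp_term_def using DERIV_divide_power[OF 0, of 1 1]
    by (intro DERIV_diff DERIV_const) (simp only: Suc_1)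
  from DERIV_imp_deriv[OF this] show ?case by (simp add: fact_numeral numeral_3_eq_3)
next
  case (Suc m)
  let ?c = "(- 1) ^ Suc m * fact (m + 2) :: complex"
  have "\<forall>\<^sub>F x in nhds z. (deriv ^^ Suc m) (wp_term w) x = ?c / (x - w) ^ Suc (m + 2)"
    using t1_space_nhds[OF Suc.prems]
  proof eventually_elim
    case (elim x)
    have "Suc (m + 2) = m + 3" by simp
    with Suc.IH[OF elim] show ?case by (simp only:)
  qed
  then have "deriv ((deriv ^^ Suc m) (wp_term w)) z = deriv (\<lambda>z. ?c / (z - w) ^ Suc (m + 2)) z"
    by (intro deriv_cong_ev refl)
  also have "\<dots> = - (of_nat (Suc (m + 2)) * ?c) / (z - w) ^ Suc (Suc (m + 2))"
    by (rule DERIV_imp_deriv[OF DERIV_divide_power[OF Suc.prems]])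
  also have "- (of_nat (Suc (m + 2)) * ?c) = (- 1) ^ Suc (Suc m) * (of_nat (Suc (m + 2)) * fact (m + 2))"
  proof -
    have "- (x * ((- 1) ^ Suc m * y)) = (- 1) ^ Suc (Suc m) * (x * y)" for x y :: complex by simp
    then show ?thesis .
  qed
  also have "of_nat (Suc (m + 2)) * fact (m + 2) = (fact (Suc (m + 2)) :: complex)"
    by (rule fact_Suc[symmetric])
  also have "Suc (m + 2) = Suc m + 2" by simp
  also have "Suc (Suc m + 2) = Suc m + 3" by simp
  finally show ?case by (simp only: funpow.simps o_apply)
qed

lemma higher_deriv_wp_term_0:
  assumes "w \<noteq> 0"
  shows "(deriv ^^ Suc m) (wp_term w) 0 = fact (m + 2) / w ^ (m + 3)"
proof -
  have "(- w) ^ (m + 3) = (- 1) ^ (m + 3) * w ^ (m + 3)" by (rule power_minus)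
  also have "(- 1) ^ (m + 3) = (- 1 :: complex) ^ Suc m" by (simp add: power_add)
  finally show ?thesis
    using higher_deriv_wp_term[of 0 w m] assms
    by (simp only: diff_0 mult_divide_mult_cancel_left_if) simp
qed

lemma higher_deriv_sum:
  fixes z :: complex
  assumes "finite I" "\<And>i. i \<in> I \<Longrightarrow> f i holomorphic_on S" "open S" "z \<in> S"
  shows "(deriv ^^ n) (\<lambda>w. \<Sum>i\<in>I. f i w) z = (\<Sum>i\<in>I. (deriv ^^ n) (f i) z)"
  using assms(1,2)
proof induction
  case (insert i I)
  have "(deriv ^^ n) (\<lambda>w. f i w + (\<Sum>i\<in>I. f i w)) z
      = (deriv ^^ n) (f i) z + (deriv ^^ n) (\<lambda>w. \<Sum>i\<in>I. f i w) z"
    by (rule higher_deriv_add[OF _ _ assms(3,4)]) (use insert.prems in \<open>auto intro!: holomorphic_on_sum\<close>)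
  with insert show ?case by simp
qed simp

text \<open>The factor \<open>k\<close> is the tail of the power series divided by
  \<open>u ^ n\<close>; its value at 0 is set to the coefficient of index \<open>n\<close>.\<close>

lemma holomorphic_taylor_remainder:
  fixes f :: "complex \<Rightarrow> complex"
  assumes f: "f holomorphic_on ball 0 r"
  shows "\<exists>k. k holomorphic_on ball 0 r \<and>
    (\<forall>u\<in>ball 0 r. f u = (\<Sum>i<n. (deriv ^^ i) f 0 / fact i * u ^ i) + u ^ n * k u)"
proof -
  define c where "c = (\<lambda>i. (deriv ^^ i) f 0 / fact i)"
  define k where "k = (\<lambda>u. if u = 0 then c n else (f u - (\<Sum>i<n. c i * u ^ i)) / u ^ n)"
  have sums: "(\<lambda>i. c (i + n) * (u - 0) ^ i) sums k u" if u: "u \<in> ball 0 r" for u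
  proof (cases "u = 0")
    case True
    then show ?thesis using powser_sums_zero[of "\<lambda>i. c (i + n)"] by (simp add: k_def)
  next
    case False
    have "(\<lambda>i. c i * u ^ i) sums f u"
      using holomorphic_power_series[OF f u] by (simp add: c_def)
    then have "(\<lambda>i. c (i + n) * u ^ (i + n)) sums (f u - (\<Sum>i<n. c i * u ^ i))"
      by (rule sums_split_initial_segment)
    then have "(\<lambda>i. c (i + n) * u ^ (i + n) / u ^ n) sums ((f u - (\<Sum>i<n. c i * u ^ i)) / u ^ n)"
      by (rule sums_divide)
    then show ?thesis using False by (simp add: k_def power_add)
  qed
  have "k holomorphic_on ball 0 r"
    by (rule power_series_holomorphic[OF sums])
  moreover have "f u = (\<Sum>i<n. c i * u ^ i) + u ^ n * k u" if "u \<in> ball 0 r" for u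
  proof (cases "u = 0")
    case True
    have "f 0 = (\<Sum>i<n. c i * 0 ^ i) + 0 ^ n * c n"
    proof (cases n)
      case 0
      then show ?thesis by (simp add: c_def)
    next
      case (Suc m)
      have "(\<Sum>i<Suc m. c i * 0 ^ i) = c 0"
        by (subst sum.lessThan_Suc_shift) simp
      then show ?thesis unfolding Suc by (simp add: c_def)
    qed
    then show ?thesis using True by (simp add: k_def)
  next
    case False
    then show ?thesis by (simp add: k_def)
  qed
  ultimately show ?thesis unfolding c_def by blast
qed

text \<open>This holds also where \<open>f\<close> is not differentiable: \<open>deriv\<close>
  selects from the set of derivatives, which the shift leaves unchanged. So periodicity can be used
  at the lattice points as well.\<close>

lemma deriv_periodic:
  assumes "\<And>z. f (z + v) = f z"
  shows "deriv f (z + v) = deriv f z"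
proof -
  have "(\<lambda>x. f (x + v)) = f" using assms by auto
  then show ?thesis unfolding deriv_def DERIV_shift by simp
qed

section \<open>Convergence, periodicity and Laurent expansion of the lattice sum\<close>

context complex_lattice
begin

text \<open>The factor 2 is that of \<open>norm_wp_term_le\<close>: on the disc of radius R these
  terms have no poles and a common summable majorant, and only finitely many lattice points are left
  out.\<close>

definition far :: "real \<Rightarrow> complex set" where
  "far R = {w \<in> L. 2 * R \<le> norm w}"

lemma summable_bound_far: "(\<lambda>w. 10 * R * (1 / norm w ^ 3)) summable_on far R"
  by (intro summable_on_cmult_right summable_on_subset_banach[OF summable_norm_cube])
     (auto simp: far_def)

lemma uniform_limit_far:
  assumes "R > 0"
  shows "uniform_limit (cball 0 R) (\<lambda>X z. \<Sum>w\<in>X. wp_term w z)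
    (\<lambda>z. \<Sum>\<^sub>\<infinity>w\<in>far R. wp_term w z) (finite_subsets_at_top (far R))"
proof (rule Weierstrass_m_test_general[OF _ summable_bound_far])
  show "norm (wp_term w z) \<le> 10 * R * (1 / norm w ^ 3)" if "w \<in> far R" "z \<in> cball 0 R" for w z
    by (rule norm_wp_term_le) (use that assms in \<open>simp_all add: far_def\<close>)
qed

lemma summable_far:
  assumes "R > 0" "norm z \<le> R"
  shows "(\<lambda>w. wp_term w z) summable_on far R"
proof (rule abs_summable_summable, rule summable_on_comparison_test[OF summable_bound_far])
  show "norm (wp_term w z) \<le> 10 * R * (1 / norm w ^ 3)" if "w \<in> far R" for w
    by (rule norm_wp_term_le) (use that assms in \<open>simp_all add: far_def\<close>)
qed simp

lemma summable_wp_term: "(\<lambda>w. wp_term w z) summable_on L"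
proof -
  define R where "R = norm z + 1"
  have R: "R > 0" "norm z \<le> R" by (auto simp: R_def add_nonneg_pos)
  have eq: "L = far R \<union> {w \<in> L. norm w < 2 * R}" by (auto simp: far_def)
  have "finite {w \<in> L. norm w < 2 * R}"
    by (rule finite_subset[OF _ finite_norm_le[of "2 * R"]]) auto
  then show ?thesis
    by (subst eq) (intro summable_on_Un_disjoint summable_far R summable_on_finite, auto simp: far_def)
qed

text \<open>
  As \<open>1 / 0 = 0\<close>, the term for \<open>w = 0\<close> is \<open>1 / z\<^sup>2\<close>, so that \<open>wp L\<close> is a sum over
  the whole lattice and stays meaningful at the lattice points.
\<close>

lemma wp_eq_infsum: "wp L z = (\<Sum>\<^sub>\<infinity>w\<in>L. wp_term w z)"
proof -
  have "(\<lambda>w. wp_term w z) summable_on (L - {0})"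
    by (rule summable_on_subset_banach[OF summable_wp_term]) blast
  then have "(\<Sum>\<^sub>\<infinity>w\<in>insert 0 (L - {0}). wp_term w z) = wp_term 0 z + (\<Sum>\<^sub>\<infinity>w\<in>L - {0}. wp_term w z)"
    by (rule infsum_insert) simp
  moreover have "insert 0 (L - {0}) = L" by auto
  ultimately show ?thesis by (simp add: wp_def wp_term_def)
qed

lemma has_sum_wp: "((\<lambda>w. wp_term w z) has_sum wp L z) L"
  unfolding wp_eq_infsum by (rule has_sum_infsum[OF summable_wp_term])

lemma wp_minus: "wp L (- z) = wp L z"
proof -
  have "(\<Sum>\<^sub>\<infinity>w\<in>L. wp_term w (- z)) = (\<Sum>\<^sub>\<infinity>w\<in>L. wp_term w z)"
    by (rule infsum_reindex_bij_witness[of _ uminus uminus])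
       (auto simp: wp_term_def power2_eq_square algebra_simps)
  then show ?thesis by (simp add: wp_eq_infsum)
qed

text \<open>
  Shifting the argument changes the sum by a constant, because the terms of the difference do not
  depend on \<open>z\<close>; by parity the constant vanishes at \<open>z = - v / 2\<close>.
\<close>

lemma wp_periodic:
  assumes v: "v \<in> L"
  shows "wp L (z + v) = wp L z"
proof -
  define d where "d = (\<lambda>w. 1 / w ^ 2 - 1 / (w + v) ^ 2)"
  have "(d has_sum (wp L (x + v) - wp L x)) L" for x
  proof -
    have "bij_betw (\<lambda>w. w + v) L L"
      by (rule bij_betwI[of _ _ _ "\<lambda>w. w - v"]) (auto intro: add_in diff_in v)
    then have "((\<lambda>w. wp_term (w + v) (x + v)) has_sum wp L (x + v)) L"
      using has_sum_wp[of "x + v"] by (rule has_sum_reindex_bij_betw[THEN iffD2])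
    from has_sum_add[OF this has_sum_uminusI[OF has_sum_wp[of x]]]
    have "((\<lambda>w. wp_term (w + v) (x + v) + - wp_term w x) has_sum (wp L (x + v) - wp L x)) L"
      by simp
    then show ?thesis by (simp add: d_def wp_term_def)
  qed
  from infsumI[OF this[of z]] infsumI[OF this[of "- (v / 2)"]]
  have "wp L (z + v) - wp L z = wp L (- (v / 2) + v) - wp L (- (v / 2))" by simp
  also have "- (v / 2) + v = v / 2" by (simp add: field_simps)
  finally show ?thesis using wp_minus[of "v / 2"] by simp
qed

lemma holomorphic_far:
  assumes "R > 0"
  shows "(\<lambda>z. \<Sum>\<^sub>\<infinity>w\<in>far R. wp_term w z) holomorphic_on ball 0 R"
proof (rule holomorphic_uniform_limit[OF _ uniform_limit_far[OF assms]])
  have hol: "wp_term w holomorphic_on cball 0 R" if "w \<in> far R" for w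
    by (rule holomorphic_on_wp_term) (use that assms in \<open>auto simp: far_def\<close>)
  show "\<forall>\<^sub>F X in finite_subsets_at_top (far R). continuous_on (cball 0 R) (\<lambda>z. \<Sum>w\<in>X. wp_term w z) \<and>
      (\<lambda>z. \<Sum>w\<in>X. wp_term w z) holomorphic_on ball 0 R"
  proof (rule eventually_finite_subsets_at_top_weakI)
    fix X assume "X \<subseteq> far R"
    then have "(\<lambda>z. \<Sum>w\<in>X. wp_term w z) holomorphic_on cball 0 R"
      by (intro holomorphic_on_sum hol) auto
    then show "continuous_on (cball 0 R) (\<lambda>z. \<Sum>w\<in>X. wp_term w z) \<and>
      (\<lambda>z. \<Sum>w\<in>X. wp_term w z) holomorphic_on ball 0 R"
      using holomorphic_on_imp_continuous_on holomorphic_on_subset ball_subset_cball by blast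
  qed
qed auto

text \<open>On each disc the sum is its far part plus finitely many rational functions, and the
  discs exhaust the plane.\<close>

lemma holomorphic_wp: "wp L holomorphic_on (- L)"
proof -
  have "wp L holomorphic_on (ball 0 R - L)" if R: "R > 0" for R
  proof -
    define N where "N = {w \<in> L. norm w < 2 * R}"
    have fin: "finite N"
      unfolding N_def by (rule finite_subset[OF _ finite_norm_le[of "2 * R"]]) auto
    have eq: "L = far R \<union> N" and disj: "far R \<inter> N = {}" by (auto simp: far_def N_def)
    have e: "(\<Sum>\<^sub>\<infinity>w\<in>far R. wp_term w z) + (\<Sum>w\<in>N. wp_term w z) = wp L z" if "z \<in> ball 0 R - L" for z
    proof -
      have "(\<Sum>\<^sub>\<infinity>w\<in>far R \<union> N. wp_term w z) = (\<Sum>\<^sub>\<infinity>w\<in>far R. wp_term w z) + (\<Sum>\<^sub>\<infinity>w\<in>N. wp_term w z)"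
        using that R fin by (intro infsum_Un_disjoint[OF _ _ disj] summable_far summable_on_finite) auto
      then show ?thesis unfolding eq[symmetric] wp_eq_infsum using fin by simp
    qed
    have "(\<lambda>z. (\<Sum>\<^sub>\<infinity>w\<in>far R. wp_term w z) + (\<Sum>w\<in>N. wp_term w z)) holomorphic_on (ball 0 R - L)"
      by (intro holomorphic_on_add holomorphic_on_sum holomorphic_on_wp_term
          holomorphic_on_subset[OF holomorphic_far[OF R]]) (auto simp: N_def)
    then show ?thesis by (rule holomorphic_transform) (rule e)
  qed
  moreover have "open (ball 0 R - L)" for R :: real
    by (intro open_Diff open_ball closed_subset subset_refl)
  ultimately have "wp L holomorphic_on (\<Union>R\<in>{0<..}. ball 0 R - L)"
    by (intro holomorphic_on_UN_open) auto
  moreover have "(\<Union>R\<in>{0<..}. ball 0 R - L) = - L"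
  proof (intro equalityI subsetI)
    fix z assume "z \<in> - L"
    then have "z \<in> ball 0 (norm z + 1) - L" by simp
    then show "z \<in> (\<Union>R\<in>{0<..}. ball 0 R - L)"
      by (intro UN_I[of "norm z + 1"]) (auto simp: add_nonneg_pos)
  qed auto
  ultimately show ?thesis by simp
qed

text \<open>Differentiating the sum term by term at 0 gives a = 3 times the sum of w^-4 and b = 5
  times the sum of w^-6, whence the factors 20 = 60/3 and 28 = 140/5. Odd coefficients vanish by
  parity, and the constant one because every summand is 0 at 0.\<close>

lemma wp_expansion:
  obtains r k a b where "r > 0" "k holomorphic_on ball 0 r"
    "invariant_g2 L = 20 * a" "invariant_g3 L = 28 * b"
    "\<And>u. u \<in> ball 0 r \<Longrightarrow> wp L u = 1 / u ^ 2 + a * u ^ 2 + b * u ^ 4 + u ^ 5 * k u"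
proof -
  have "finite {w \<in> L. norm w \<le> 1}" by (rule finite_norm_le)
  then have "\<exists>d>0. \<forall>w\<in>{w \<in> L. norm w \<le> 1}. w \<noteq> 0 \<longrightarrow> d \<le> dist 0 w"
    by (rule finite_set_avoid)
  then obtain d where d: "d > 0" "\<And>w. w \<in> L \<Longrightarrow> norm w \<le> 1 \<Longrightarrow> w \<noteq> 0 \<Longrightarrow> d \<le> norm w"
    by auto
  \<comment> \<open>The radius is chosen to make \<open>far r\<close> all of \<open>L\<close> except
    0. The minimum with 1 serves the lattice points of norm above 1, of which \<open>d\<close> says
    nothing.\<close>
  define r where "r = min d 1 / 2"
  have r: "r > 0" using d by (simp add: r_def)
  have far: "far r = L - {0}"
  proof (intro equalityI subsetI)
    fix w assume "w \<in> L - {0}"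
    then show "w \<in> far r" using d(2)[of w] by (cases "norm w \<le> 1") (auto simp: far_def r_def)
  qed (use r in \<open>auto simp: far_def\<close>)
  define h where "h = (\<lambda>z. \<Sum>\<^sub>\<infinity>w\<in>L - {0}. wp_term w z)"
  have holh: "h holomorphic_on ball 0 r"
    using holomorphic_far[OF r] unfolding far h_def .
  have hm: "h (- z) = h z" for z
    unfolding h_def
    by (rule infsum_reindex_bij_witness[of _ uminus uminus])
       (auto simp: wp_term_def power2_eq_square algebra_simps)
  have odd0: "(deriv ^^ i) h 0 = 0" if "odd i" for i
  proof -
    have "(deriv ^^ i) (\<lambda>w. h (- 1 * w)) 0 = (- 1) ^ i * (deriv ^^ i) h (- 1 * 0)"
      by (rule higher_deriv_compose_linear[OF holh open_ball open_ball, of 0 0 r]) (use r in auto)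
    moreover have "(\<lambda>w. h (- 1 * w)) = h" by (simp add: hm)
    ultimately have e: "(deriv ^^ i) h 0 = - (deriv ^^ i) h 0" using that by simp
    have "x = 0" if "x = - x" for x :: complex
      using that by (simp add: complex_eq_iff)
    from this[OF e] show ?thesis .
  qed
  have ul: "uniform_limit (ball 0 r) (\<lambda>X z. \<Sum>w\<in>X. wp_term w z) h (finite_subsets_at_top (L - {0}))"
    using uniform_limit_on_subset[OF uniform_limit_far[OF r] ball_subset_cball]
    unfolding far h_def .
  have holt: "wp_term w holomorphic_on ball 0 r" if "w \<in> L - {0}" for w
  proof (rule holomorphic_on_wp_term)
    have "w \<in> far r" using that by (simp only: far)
    then show "w \<notin> ball 0 r" using r by (simp add: far_def)
  qed
  have hs: "((\<lambda>w. fact (m + 2) / w ^ (m + 3)) has_sum (deriv ^^ Suc m) h 0) (L - {0})" for m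
  proof -
    have "((\<lambda>X. (deriv ^^ Suc m) (\<lambda>z. \<Sum>w\<in>X. wp_term w z) 0) \<longlongrightarrow> (deriv ^^ Suc m) h 0)
        (finite_subsets_at_top (L - {0}))"
      by (rule higher_deriv_complex_uniform_limit[OF ul])
         (use r in \<open>auto intro!: eventually_finite_subsets_at_top_weakI holomorphic_on_sum holt\<close>)
    moreover have "\<forall>\<^sub>F X in finite_subsets_at_top (L - {0}).
        (deriv ^^ Suc m) (\<lambda>z. \<Sum>w\<in>X. wp_term w z) 0 = (\<Sum>w\<in>X. fact (m + 2) / w ^ (m + 3))"
    proof (rule eventually_finite_subsets_at_top_weakI)
      fix X assume X: "finite X" "X \<subseteq> L - {0}"
      have "(deriv ^^ Suc m) (\<lambda>z. \<Sum>w\<in>X. wp_term w z) 0 = (\<Sum>w\<in>X. (deriv ^^ Suc m) (wp_term w) 0)"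
        by (rule higher_deriv_sum[OF X(1) _ open_ball[of 0 r]]) (use X r holt in auto)
      also have "\<dots> = (\<Sum>w\<in>X. fact (m + 2) / w ^ (m + 3))"
        by (intro sum.cong refl higher_deriv_wp_term_0) (use X in auto)
      finally show "(deriv ^^ Suc m) (\<lambda>z. \<Sum>w\<in>X. wp_term w z) 0 = (\<Sum>w\<in>X. fact (m + 2) / w ^ (m + 3))" .
    qed
    ultimately show ?thesis unfolding has_sum_def by (rule Lim_transform_eventually)
  qed
  define a where "a = (deriv ^^ 2) h 0 / 2"
  define b where "b = (deriv ^^ 4) h 0 / 24"
  have d2: "(deriv ^^ 2) h 0 = 6 * (\<Sum>\<^sub>\<infinity>w\<in>L - {0}. 1 / w ^ 4)"
  proof -
    have e: "(\<lambda>w::complex. fact (1 + 2) / w ^ (1 + 3)) = (\<lambda>w. 6 * (1 / w ^ 4))"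
      by (simp add: fact_numeral)
    have "(deriv ^^ Suc 1) h 0 = (\<Sum>\<^sub>\<infinity>w\<in>L - {0}. 6 * (1 / w ^ 4))"
      using infsumI[OF hs[of 1]] unfolding e by simp
    also have "\<dots> = 6 * (\<Sum>\<^sub>\<infinity>w\<in>L - {0}. 1 / w ^ 4)" by (rule infsum_cmult_right')
    finally show ?thesis by (simp add: numeral_2_eq_2)
  qed
  have d4: "(deriv ^^ 4) h 0 = 120 * (\<Sum>\<^sub>\<infinity>w\<in>L - {0}. 1 / w ^ 6)"
  proof -
    have e: "(\<lambda>w::complex. fact (3 + 2) / w ^ (3 + 3)) = (\<lambda>w. 120 * (1 / w ^ 6))"
      by (simp add: fact_numeral)
    have "(deriv ^^ Suc 3) h 0 = (\<Sum>\<^sub>\<infinity>w\<in>L - {0}. 120 * (1 / w ^ 6))"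
      using infsumI[OF hs[of 3]] unfolding e by simp
    also have "\<dots> = 120 * (\<Sum>\<^sub>\<infinity>w\<in>L - {0}. 1 / w ^ 6)" by (rule infsum_cmult_right')
    finally show ?thesis by (simp add: eval_nat_numeral)
  qed
  \<comment> \<open>Order 5 is what the curve equation requires: in the cube of \<open>wp\<close>
    the remainder is multiplied by at most a multiple of u^-4 and still tends to 0.\<close>
  obtain k where k: "k holomorphic_on ball 0 r"
    "\<And>u. u \<in> ball 0 r \<Longrightarrow> h u = (\<Sum>i<5. (deriv ^^ i) h 0 / fact i * u ^ i) + u ^ 5 * k u"
    using holomorphic_taylor_remainder[OF holh, of 5] by blast
  have h0: "h 0 = 0" by (simp add: h_def wp_term_def)
  have sum5: "(\<Sum>i<5. (deriv ^^ i) h 0 / fact i * u ^ i) = a * u ^ 2 + b * u ^ 4" for u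
  proof -
    have "{..<5::nat} = {0, 1, 2, 3, 4}" by auto
    then show ?thesis
      using odd0[of 1] odd0[of 3] h0 by (simp add: a_def b_def fact_numeral)
  qed
  show ?thesis
  proof (rule that[OF r k(1)])
    show "invariant_g2 L = 20 * a" by (simp add: invariant_g2_def a_def d2)
    show "invariant_g3 L = 28 * b" by (simp add: invariant_g3_def b_def d4)
    show "wp L u = 1 / u ^ 2 + a * u ^ 2 + b * u ^ 4 + u ^ 5 * k u" if "u \<in> ball 0 r" for u
    proof -
      have "wp L u = 1 / u ^ 2 + h u" by (simp add: wp_def h_def wp_term_def)
      then show ?thesis using k(2)[OF that] unfolding sum5 by (simp add: add.assoc)
    qed
  qed
qed

end

section \<open>The differential equations\<close>

context complex_lattice
begin

abbreviation p where "p \<equiv> wp L"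
abbreviation p1 where "p1 \<equiv> deriv (wp L)"

lemma open_Compl_lattice: "open (- L)"
  by (intro open_Compl closed_subset subset_refl)

lemma deriv_wp: "z \<notin> L \<Longrightarrow> (p has_field_derivative p1 z) (at z)"
  using holomorphic_derivI[OF holomorphic_wp open_Compl_lattice] by simp

lemma holomorphic_deriv_wp: "p1 holomorphic_on (- L)"
  by (rule holomorphic_deriv[OF holomorphic_wp open_Compl_lattice])

lemma deriv_deriv_wp: "z \<notin> L \<Longrightarrow> (p1 has_field_derivative deriv p1 z) (at z)"
  using holomorphic_derivI[OF holomorphic_deriv_wp open_Compl_lattice] by simp

lemma deriv_wp_periodic: "v \<in> L \<Longrightarrow> p1 (z + v) = p1 z"
  by (rule deriv_periodic) (rule wp_periodic)

lemma deriv_deriv_wp_periodic: "v \<in> L \<Longrightarrow> deriv p1 (z + v) = deriv p1 z"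
  by (rule deriv_periodic) (rule deriv_wp_periodic)

text \<open>By periodicity the limit at every lattice point is 0, so extending by 0 gives an entire
  function. It is bounded because it takes all its values on a disc, and its constant value is the
  one at the lattice point 0.\<close>

lemma periodic_eq_zero:
  assumes hol: "f holomorphic_on (- L)" and per: "\<And>v z. v \<in> L \<Longrightarrow> f (z + v) = f z"
    and lim: "f \<midarrow>0\<rightarrow> 0" and z: "z \<notin> L"
  shows "f z = 0"
proof -
  define F where "F = (\<lambda>z. if z \<in> L then 0 else f z)"
  have "F holomorphic_on (- (L - {v}))" if v: "v \<in> L" for v
  proof -
    have o: "open (- (L - {v}))" by (intro open_Compl closed_subset Diff_subset)
    have "- (L - {v}) - {v} = - L" using v by blast
    then have h: "f holomorphic_on (- (L - {v}) - {v})" using hol by simp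
    have "(\<lambda>h. f (v + h)) \<midarrow>0\<rightarrow> 0" using lim per[OF v] by (simp add: add.commute)
    then have "f \<midarrow>v\<rightarrow> 0" by (rule LIM_offset_zero_cancel)
    from removable_singularity[OF h o this]
    show ?thesis
      by (rule holomorphic_transform) (use v in \<open>auto simp: F_def\<close>)
  qed
  then have "F holomorphic_on (\<Union>v\<in>L. - (L - {v}))"
    by (intro holomorphic_on_UN_open open_Compl closed_subset Diff_subset)
  moreover have "(\<Union>v\<in>L. - (L - {v})) = UNIV"
    using zero_in by blast
  ultimately have holF: "F holomorphic_on UNIV" by simp
  have perF: "F (z + v) = F z" if "v \<in> L" for z v
    using that per add_iff by (simp add: F_def)
  obtain M where M: "\<And>z. \<exists>w\<in>L. norm (z - w) \<le> M" using bounded_representatives by blast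
  have "range F \<subseteq> F ` cball 0 M"
  proof
    fix y assume "y \<in> range F"
    then obtain x where x: "y = F x" by blast
    obtain w where w: "w \<in> L" "norm (x - w) \<le> M" using M by blast
    have "y = F (x - w)" using perF[OF w(1), of "x - w"] x by simp
    then show "y \<in> F ` cball 0 M" using w(2) by auto
  qed
  moreover have "compact (F ` cball 0 M)"
    by (intro compact_continuous_image compact_cball
        continuous_on_subset[OF holomorphic_on_imp_continuous_on[OF holF] subset_UNIV])
  ultimately have "bounded (range F)"
    by (intro bounded_subset[OF compact_imp_bounded])
  then have "F constant_on UNIV" by (rule Liouville_theorem[OF holF])
  then obtain c where c: "\<And>x. F x = c" unfolding constant_on_def by blast
  have "F z = F 0" using c by simp
  then show ?thesis using z by (simp add: F_def)
qed

text \<open>Here \<open>k1\<close> and \<open>k2\<close> are the first two derivatives of the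
  remainder factor \<open>k\<close>; for the limits at 0 only their continuity there
  matters.\<close>

lemma laurent:
  obtains r k k1 k2 a b where "r > 0" "invariant_g2 L = 20 * a" "invariant_g3 L = 28 * b"
    "isCont k 0" "isCont k1 0" "isCont k2 0"
    "\<And>u. u \<noteq> 0 \<Longrightarrow> norm u < r \<Longrightarrow> p u = 1 / u ^ 2 + (a * u ^ 2 + b * u ^ 4 + u ^ 5 * k u)"
    "\<And>u. u \<noteq> 0 \<Longrightarrow> norm u < r \<Longrightarrow>
      p1 u = - 2 / u ^ 3 + (2 * a * u + 4 * b * u ^ 3 + u ^ 4 * (5 * k u + u * k1 u))"
    "\<And>u. u \<noteq> 0 \<Longrightarrow> norm u < r \<Longrightarrow>
      deriv p1 u = 6 / u ^ 4 + (2 * a + 12 * b * u ^ 2 + u ^ 3 * (20 * k u + 10 * u * k1 u + u ^ 2 * k2 u))"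
proof (rule wp_expansion)
  fix r :: real and k and a b :: complex
  assume r: "r > 0" and k: "k holomorphic_on ball 0 r"
    and ab: "invariant_g2 L = 20 * a" "invariant_g3 L = 28 * b"
    and e: "\<And>u. u \<in> ball 0 r \<Longrightarrow> wp L u = 1 / u ^ 2 + a * u ^ 2 + b * u ^ 4 + u ^ 5 * k u"
  define k1 where "k1 = deriv k"
  define k2 where "k2 = deriv k1"
  have hk1: "k1 holomorphic_on ball 0 r" unfolding k1_def by (rule holomorphic_deriv[OF k open_ball])
  have hk2: "k2 holomorphic_on ball 0 r" unfolding k2_def by (rule holomorphic_deriv[OF hk1 open_ball])
  have dk: "(k has_field_derivative k1 u) (at u)" if "u \<in> ball 0 r" for u
    unfolding k1_def by (rule holomorphic_derivI[OF k open_ball that])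
  have dk1: "(k1 has_field_derivative k2 u) (at u)" if "u \<in> ball 0 r" for u
    unfolding k2_def by (rule holomorphic_derivI[OF hk1 open_ball that])
  have cont: "isCont g 0" if "g holomorphic_on ball 0 r" for g
    using holomorphic_on_imp_continuous_on[OF that] r by (simp add: continuous_on_eq_continuous_at)
  let ?S = "ball 0 r - {0}"
  have oS: "open ?S" by (intro open_Diff open_ball closed_singleton)
  have inv: "((\<lambda>u. c / u ^ Suc n) has_field_derivative - (of_nat (Suc n) * c) / u ^ Suc (Suc n)) (at u)"
    if "u \<noteq> 0" for u c :: complex and n
    using DERIV_divide_power[of u 0 c n] that by simp
  have E1: "p1 u = - 2 / u ^ 3 + (2 * a * u + 4 * b * u ^ 3 + u ^ 4 * (5 * k u + u * k1 u))"
    if u: "u \<in> ?S" for u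
  proof -
    have "((\<lambda>u. a * u ^ 2 + b * u ^ 4 + u ^ 5 * k u) has_field_derivative
        2 * a * u + 4 * b * u ^ 3 + u ^ 4 * (5 * k u + u * k1 u)) (at u)"
      using u by (auto intro!: derivative_eq_intros dk simp: algebra_simps eval_nat_numeral)
    from DERIV_add[OF inv[of u 1 1] this] have
      "((\<lambda>u. 1 / u ^ 2 + (a * u ^ 2 + b * u ^ 4 + u ^ 5 * k u)) has_field_derivative
        - 2 / u ^ 3 + (2 * a * u + 4 * b * u ^ 3 + u ^ 4 * (5 * k u + u * k1 u))) (at u)"
      using u by (simp add: numeral_2_eq_2 numeral_3_eq_3)
    then have "(p has_field_derivative
        - 2 / u ^ 3 + (2 * a * u + 4 * b * u ^ 3 + u ^ 4 * (5 * k u + u * k1 u))) (at u)"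
      by (rule has_field_derivative_transform_within_open[OF _ oS u]) (simp add: e add.assoc)
    then show ?thesis by (rule DERIV_imp_deriv)
  qed
  have E2: "deriv p1 u = 6 / u ^ 4 + (2 * a + 12 * b * u ^ 2 + u ^ 3 * (20 * k u + 10 * u * k1 u + u ^ 2 * k2 u))"
    if u: "u \<in> ?S" for u
  proof -
    have "((\<lambda>u. 2 * a * u + 4 * b * u ^ 3 + u ^ 4 * (5 * k u + u * k1 u)) has_field_derivative
        2 * a + 12 * b * u ^ 2 + u ^ 3 * (20 * k u + 10 * u * k1 u + u ^ 2 * k2 u)) (at u)"
      using u by (auto intro!: derivative_eq_intros dk dk1 simp: algebra_simps eval_nat_numeral)
    from DERIV_add[OF inv[of u "- 2" 2] this] have
      "((\<lambda>u. - 2 / u ^ 3 + (2 * a * u + 4 * b * u ^ 3 + u ^ 4 * (5 * k u + u * k1 u))) has_field_derivative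
        6 / u ^ 4 + (2 * a + 12 * b * u ^ 2 + u ^ 3 * (20 * k u + 10 * u * k1 u + u ^ 2 * k2 u))) (at u)"
      using u by (simp add: eval_nat_numeral)
    then have "(p1 has_field_derivative
        6 / u ^ 4 + (2 * a + 12 * b * u ^ 2 + u ^ 3 * (20 * k u + 10 * u * k1 u + u ^ 2 * k2 u))) (at u)"
      by (rule has_field_derivative_transform_within_open[OF _ oS u]) (simp only: E1)
    then show ?thesis by (rule DERIV_imp_deriv)
  qed
  show thesis
    by (rule that[OF r ab cont[OF k] cont[OF hk1] cont[OF hk2]])
       (simp add: e add.assoc, simp_all add: E1 E2)
qed

text \<open>In both equations the difference of the two sides is periodic. At 0 its polar and
  constant terms cancel because g2 = 20a and g3 = 28b: the balances are 2 - 12 + 10 = 0, then -8 -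
  12 + 20 = 0 and -16 - 12 + 28 = 0.\<close>

lemma wp_second_order_and_curve:
  shows "z \<notin> L \<Longrightarrow> deriv p1 z = 6 * p z ^ 2 - invariant_g2 L / 2"
    and "z \<notin> L \<Longrightarrow> p1 z ^ 2 = 4 * p z ^ 3 - invariant_g2 L * p z - invariant_g3 L"
    and "(\<lambda>z. p z - 1 / z ^ 2) \<midarrow>0\<rightarrow> 0"
    and "(\<lambda>z. p1 z + 2 / z ^ 3) \<midarrow>0\<rightarrow> 0"
proof -
  obtain r k k1 k2 a b where r: "r > 0" and ab: "invariant_g2 L = 20 * a" "invariant_g3 L = 28 * b"
    and cont: "isCont k 0" "isCont k1 0" "isCont k2 0"
    and e: "\<And>u. u \<noteq> 0 \<Longrightarrow> norm u < r \<Longrightarrow> p u = 1 / u ^ 2 + (a * u ^ 2 + b * u ^ 4 + u ^ 5 * k u)"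
    "\<And>u. u \<noteq> 0 \<Longrightarrow> norm u < r \<Longrightarrow>
      p1 u = - 2 / u ^ 3 + (2 * a * u + 4 * b * u ^ 3 + u ^ 4 * (5 * k u + u * k1 u))"
    "\<And>u. u \<noteq> 0 \<Longrightarrow> norm u < r \<Longrightarrow>
      deriv p1 u = 6 / u ^ 4 + (2 * a + 12 * b * u ^ 2 + u ^ 3 * (20 * k u + 10 * u * k1 u + u ^ 2 * k2 u))"
    by (rule laurent) blast
  have k: "k \<midarrow>0\<rightarrow> k 0" "k1 \<midarrow>0\<rightarrow> k1 0" "k2 \<midarrow>0\<rightarrow> k2 0"
    using cont by (simp_all only: isCont_def)
  have near: "\<forall>\<^sub>F u in at 0. u \<noteq> 0 \<and> norm u < r"
    using r unfolding eventually_at by (intro exI[of _ r]) auto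
  define m where "m = (\<lambda>u. a * u ^ 2 + b * u ^ 4 + u ^ 5 * k u)"
  define n where "n = (\<lambda>u. 5 * k u + u * k1 u)"
  define m1 where "m1 = (\<lambda>u. 2 * a * u + 4 * b * u ^ 3 + u ^ 4 * n u)"
  define q where "q = (\<lambda>u. 20 * k u + 10 * u * k1 u + u ^ 2 * k2 u)"
  have m: "m \<midarrow>0\<rightarrow> 0" unfolding m_def by (rule tendsto_eq_intros k refl)+ simp
  have n: "n \<midarrow>0\<rightarrow> 5 * k 0" unfolding n_def by (rule tendsto_eq_intros k refl)+ simp
  have m1: "m1 \<midarrow>0\<rightarrow> 0" unfolding m1_def by (rule tendsto_eq_intros n refl)+ simp
  have q: "q \<midarrow>0\<rightarrow> 20 * k 0" unfolding q_def by (rule tendsto_eq_intros k refl)+ simp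
  have E: "p u = 1 / u ^ 2 + m u" "p1 u = - 2 / u ^ 3 + m1 u"
    "deriv p1 u = 6 / u ^ 4 + (2 * a + 12 * b * u ^ 2 + u ^ 3 * q u)" if u: "u \<noteq> 0 \<and> norm u < r" for u
    unfolding m_def m1_def n_def q_def by (rule e[OF conjunct1[OF u] conjunct2[OF u]])+
  show lim: "(\<lambda>z. p z - 1 / z ^ 2) \<midarrow>0\<rightarrow> 0"
    by (rule Lim_transform_eventually[OF m]) (use near in eventually_elim, simp add: E)
  show "(\<lambda>z. p1 z + 2 / z ^ 3) \<midarrow>0\<rightarrow> 0"
    by (rule Lim_transform_eventually[OF m1]) (use near in eventually_elim, simp add: E)
  have mu2: "m u / u ^ 2 = a + b * u ^ 2 + u ^ 3 * k u" and mu4: "m u / u ^ 4 = a / u ^ 2 + b + u * k u"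
    and m1u: "m1 u / u ^ 3 = 2 * a / u ^ 2 + 4 * b + u * n u" if "u \<noteq> 0" for u
    using that unfolding m_def m1_def by (simp_all add: field_simps eval_nat_numeral)
  show "deriv p1 z = 6 * p z ^ 2 - invariant_g2 L / 2" if "z \<notin> L"
  proof -
    let ?f = "\<lambda>z. deriv p1 z - (6 * p z ^ 2 - invariant_g2 L / 2)"
    have "?f z = 0"
    proof (rule periodic_eq_zero[OF _ _ _ that])
      show "?f holomorphic_on - L"
        by (intro holomorphic_intros holomorphic_wp holomorphic_deriv[OF holomorphic_deriv_wp open_Compl_lattice]) auto
      show "?f (x + v) = ?f x" if "v \<in> L" for x v
        using that by (simp only: deriv_deriv_wp_periodic wp_periodic)
      have "(\<lambda>u. u ^ 3 * (q u - 12 * k u) - 6 * m u ^ 2) \<midarrow>0\<rightarrow> 0"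
        by (rule tendsto_eq_intros m q k refl)+ simp
      then show "?f \<midarrow>0\<rightarrow> 0"
      proof (rule Lim_transform_eventually)
        show "\<forall>\<^sub>F u in at 0. u ^ 3 * (q u - 12 * k u) - 6 * m u ^ 2 = ?f u"
          using near
        proof eventually_elim
          case (elim u)
          have "p u ^ 2 = 1 / u ^ 4 + 2 * (m u / u ^ 2) + m u ^ 2"
            using elim by (simp add: E power2_sum power_divide flip: power_mult)
          then show ?case using elim by (simp add: E ab mu2 algebra_simps)
        qed
      qed
    qed
    then show ?thesis by simp
  qed
  show "p1 z ^ 2 = 4 * p z ^ 3 - invariant_g2 L * p z - invariant_g3 L" if "z \<notin> L"
  proof -
    let ?f = "\<lambda>z. p1 z ^ 2 - (4 * p z ^ 3 - invariant_g2 L * p z - invariant_g3 L)"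
    \<comment> \<open>What is left of \<open>?f\<close> near 0 after the polar and constant terms
      have cancelled; every summand tends to 0.\<close>
    let ?h = "\<lambda>u. m1 u ^ 2 - 4 * u * n u - 12 * u * k u - 12 * u ^ 2 * (a + b * u ^ 2 + u ^ 3 * k u) ^ 2
      - 4 * m u ^ 3 + 20 * a * m u"
    have "?f z = 0"
    proof (rule periodic_eq_zero[OF _ _ _ that])
      show "?f holomorphic_on - L"
        by (intro holomorphic_intros holomorphic_wp holomorphic_deriv_wp)
      show "?f (x + v) = ?f x" if "v \<in> L" for x v
        using that by (simp only: deriv_wp_periodic wp_periodic)
      have "?h \<midarrow>0\<rightarrow> 0"
        by (rule tendsto_eq_intros m m1 n k refl)+ simp
      then show "?f \<midarrow>0\<rightarrow> 0"
      proof (rule Lim_transform_eventually)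
        show "\<forall>\<^sub>F u in at 0. ?h u = ?f u"
          using near
        proof eventually_elim
          case (elim u)
          then have u: "u \<noteq> 0" by simp
          have "(- 2 / u ^ 3 + x) ^ 2 = 4 / u ^ 6 - 4 * (x / u ^ 3) + x ^ 2" for x
            using u by (simp add: field_simps eval_nat_numeral)
          then have 1: "p1 u ^ 2 = 4 / u ^ 6 - 4 * (m1 u / u ^ 3) + m1 u ^ 2"
            by (simp only: E[OF elim])
          have 2: "p u ^ 3 = 1 / u ^ 6 + 3 * (m u / u ^ 4) + 3 * u ^ 2 * (m u / u ^ 2) ^ 2 + m u ^ 3"
            using elim by (simp add: E field_simps eval_nat_numeral)
          have 3: "p u = 1 / u ^ 2 + m u" using elim by (simp add: E)
          show ?case
            unfolding 1 2 unfolding mu2[OF u] mu4[OF u] m1u[OF u] ab 3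
            by (simp add: algebra_simps)
        qed
      qed
    qed
    then show ?thesis by simp
  qed
qed

lemma solution_wp: "weierstrass_solution (invariant_g2 L) (invariant_g3 L) L p p1"
proof
  show "closed L" by (intro closed_subset subset_refl)
  show "Countable_Set.countable L" by (rule countable)
  show "(p has_field_derivative p1 z) (at z)" if "z \<notin> L" for z by (rule deriv_wp[OF that])
  show "(p1 has_field_derivative 6 * p z ^ 2 - invariant_g2 L / 2) (at z)" if "z \<notin> L" for z
    using deriv_deriv_wp[OF that] wp_second_order_and_curve(1)[OF that] by simp
qed (use wp_second_order_and_curve in auto)

end

section \<open>Real points\<close>

text \<open>Conjugation preserves the equations because their coefficients are real, and it moves
  the poles to the conjugate of \<open>A\<close>.\<close>

lemma weierstrass_solution_cnj:
  assumes "weierstrass_solution (of_real g2) (of_real g3) A p p1"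
  shows "weierstrass_solution (of_real g2) (of_real g3) (cnj ` A)
    (\<lambda>z. cnj (p (cnj z))) (\<lambda>z. cnj (p1 (cnj z)))"
proof -
  interpret weierstrass_solution "of_real g2" "of_real g3" A p p1 by fact
  have notin: "cnj z \<notin> A" if "z \<notin> cnj ` A" for z
  proof
    assume "cnj z \<in> A"
    then have "cnj (cnj z) \<in> cnj ` A" by (rule imageI)
    with that show False by simp
  qed
  have cnj0: "cnj \<midarrow>0\<rightarrow> 0"
    using tendsto_cnj[OF tendsto_ident_at[of 0 UNIV]] by simp
  have compose: "(\<lambda>z. cnj (f (cnj z))) \<midarrow>0\<rightarrow> 0" if "f \<midarrow>0\<rightarrow> 0" for f :: "complex \<Rightarrow> complex"
  proof -
    have "(\<lambda>z. f (cnj z)) \<midarrow>0\<rightarrow> 0"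
      by (rule LIM_compose2[OF cnj0 that]) (intro exI[of _ 1], auto)
    from tendsto_cnj[OF this] show ?thesis by simp
  qed
  show ?thesis
  proof
    show "closed (cnj ` A)"
      unfolding image_cnj_conv_vimage_cnj by (intro closed_vimage closed_poles continuous_intros)
    show "countable (cnj ` A)" by (intro countable_image countable_poles)
    fix z assume "z \<notin> cnj ` A"
    note z = notin[OF this]
    show "((\<lambda>z. cnj (p (cnj z))) has_field_derivative cnj (p1 (cnj z))) (at z)"
      using has_field_derivative_cnj_cnj[OF deriv_p[OF z]] by (simp only: o_def)
    show "((\<lambda>z. cnj (p1 (cnj z))) has_field_derivative 6 * cnj (p (cnj z)) ^ 2 - of_real g2 / 2) (at z)"
      using has_field_derivative_cnj_cnj[OF deriv_p1[OF z]] by (simp add: o_def)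
    have "cnj (p1 (cnj z) ^ 2) = cnj (4 * p (cnj z) ^ 3 - of_real g2 * p (cnj z) - of_real g3)"
      by (simp only: curve[OF z])
    then show "cnj (p1 (cnj z)) ^ 2 = 4 * cnj (p (cnj z)) ^ 3 - of_real g2 * cnj (p (cnj z)) - of_real g3"
      by simp
  next
    show "(\<lambda>z. cnj (p (cnj z)) - 1 / z ^ 2) \<midarrow>0\<rightarrow> 0"
      using compose[OF pole] by simp
    show "(\<lambda>z. cnj (p1 (cnj z)) + 2 / z ^ 3) \<midarrow>0\<rightarrow> 0"
      using compose[OF pole1] by simp
  qed
qed

text \<open>Off both pole sets the solution equals its conjugate by uniqueness. This holds on an
  open set around the real point, so the derivatives agree there too.\<close>

lemma weierstrass_solution_real:
  assumes sol: "weierstrass_solution (of_real g2) (of_real g3) A p p1"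
    and t: "complex_of_real t \<notin> A"
  shows "p (of_real t) \<in> \<real>" "p1 (of_real t) \<in> \<real>"
proof -
  interpret weierstrass_solution "of_real g2" "of_real g3" A p p1 by fact
  note sol' = weierstrass_solution_cnj[OF sol]
  interpret C: weierstrass_solution "of_real g2" "of_real g3" "cnj ` A"
    "\<lambda>z. cnj (p (cnj z))" "\<lambda>z. cnj (p1 (cnj z))" by (rule sol')
  let ?U = "- (A \<union> cnj ` A)"
  have U: "open ?U" by (intro open_Compl closed_Un closed_poles C.closed_poles)
  have "of_real t \<notin> cnj ` A"
  proof
    assume "complex_of_real t \<in> cnj ` A"
    then obtain a where "a \<in> A" "complex_of_real t = cnj a" by blast
    then have "a = of_real t" by (metis complex_cnj_cnj complex_cnj_complex_of_real)
    with \<open>a \<in> A\<close> t show False by simp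
  qed
  then have tU: "complex_of_real t \<in> ?U" using t by simp
  have eq: "p z = cnj (p (cnj z))" if "z \<in> ?U" for z
    by (rule weierstrass_solution_unique[OF sol sol']) (use that in auto)
  have "p (of_real t) = cnj (p (of_real t))" using eq[OF tU] by simp
  then show "p (of_real t) \<in> \<real>" by (simp add: Reals_cnj_iff)
  have "(p has_field_derivative cnj (p1 (cnj (of_real t)))) (at (of_real t))"
    by (rule has_field_derivative_transform_within_open[OF C.deriv_p U tU])
       (use tU eq in auto)
  from DERIV_unique[OF this deriv_p[OF t]] show "p1 (of_real t) \<in> \<real>"
    by (simp add: Reals_cnj_iff)
qed

section \<open>Zeros of the derivative and multiples of a point\<close>

context complex_lattice
begin

sublocale weierstrass_solution "invariant_g2 L" "invariant_g3 L" L p p1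
  by (rule solution_wp)

lemma deriv_wp_minus: "z \<notin> L \<Longrightarrow> p1 (- z) = - p1 z"
proof -
  assume z: "z \<notin> L"
  have "((\<lambda>u. p (0 - u)) has_field_derivative - p1 (0 - z)) (at z)"
    by (rule deriv_reflect) (use z in simp)
  then have "(p has_field_derivative - p1 (- z)) (at z)" by (simp add: wp_minus)
  from arg_cong[OF DERIV_unique[OF this deriv_wp[OF z]], of uminus] show ?thesis
    by (simp only: minus_minus)
qed

text \<open>If \<open>p1 w = 0\<close>, the cleared duplication formula makes the second derivative
  vanish too. Then \<open>p w\<close> is a double root of the cubic, and the discriminant is
  0.\<close>

lemma deriv_wp_nonzero:
  assumes disc: "invariant_g2 L ^ 3 - 27 * invariant_g3 L ^ 2 \<noteq> 0"
    and w: "w \<notin> L" "2 * w \<notin> L"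
  shows "p1 w \<noteq> 0"
proof
  assume 0: "p1 w = 0"
  have "6 * p w ^ 2 - invariant_g2 L / 2 = 0"
    using duplication_cleared[OF w] 0 by simp
  then have g2: "invariant_g2 L = 12 * p w ^ 2" by (simp add: field_simps)
  have "invariant_g3 L = - 8 * p w ^ 3"
    using curve[OF w(1)] 0 unfolding g2 by (simp add: algebra_simps power2_eq_square power3_eq_cube)
  then have "invariant_g2 L ^ 3 - 27 * invariant_g3 L ^ 2 = 0"
    unfolding g2 by (simp add: algebra_simps eval_nat_numeral)
  with disc show False by simp
qed

text \<open>For equal abscissae the left side of the cleared addition theorem is 0. Taken at
  \<open>u + w\<close> it makes the ordinates equal, at \<open>u - w\<close> opposite.\<close>

lemma wp_eq_imp_deriv_eq_zero:
  assumes "u \<notin> L" "w \<notin> L" "u + w \<notin> L" "u - w \<notin> L" and eq: "p u = p w"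
  shows "p1 w = 0"
proof -
  have "p1 u = p1 w"
    using addition_cleared[of "u + w" u] assms by simp
  moreover have "p1 u + p1 w = 0"
    using addition_cleared[of "u - w" u] assms by (simp add: wp_minus deriv_wp_minus)
  ultimately show ?thesis by simp
qed

text \<open>Since no positive multiple of \<open>z\<close> is a lattice point, the partial sums
  starting from the point itself never reach \<open>Infinity\<close>. Only the step from 1 to 2 is a
  tangent; all later ones are chords with distinct abscissae.\<close>

lemma ec_mult_wp:
  assumes disc: "invariant_g2 L ^ 3 - 27 * invariant_g3 L ^ 2 \<noteq> 0"
    and z: "\<And>n. n \<ge> 1 \<Longrightarrow> of_nat n * z \<notin> L" and n: "n \<ge> 1"
  shows "ec_mult (invariant_g2 L) n (Affine (p z, p1 z)) = Affine (p (of_nat n * z), p1 (of_nat n * z))"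
  using n
proof (induction n rule: dec_induct)
  case base
  show ?case by (simp add: ec_mult_def)
next
  case (step n)
  let ?w = "of_nat n * z"
  have z1: "z \<notin> L" using z[of 1] by simp
  have z2: "2 * z \<notin> L" using z[of 2] by simp
  have w: "?w \<notin> L" using z[of n] step.hyps by simp
  have S: "of_nat (Suc n) * z = z + ?w" by (simp add: algebra_simps)
  have sum: "z + ?w \<notin> L" using z[of "Suc n"] unfolding S by simp
  have nz: "p1 z \<noteq> 0" by (rule deriv_wp_nonzero[OF disc z1 z2])
  have "ec_mult (invariant_g2 L) (Suc n) (Affine (p z, p1 z))
      = ec_add (invariant_g2 L) (Affine (p z, p1 z)) (Affine (p ?w, p1 ?w))"
    using step.IH by (simp add: ec_mult_def)
  also have "\<dots> = Affine (p (z + ?w), p1 (z + ?w))"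
  proof (cases "n = 1")
    case True
    have w1: "?w = z" using True by simp
    have ne: "p1 z \<noteq> - p1 z"
    proof
      assume "p1 z = - p1 z"
      then have "2 * p1 z = 0" by (simp add: mult_2[symmetric] add_eq_0_iff)
      with nz show False by simp
    qed
    have l: "(12 * p z ^ 2 - invariant_g2 L) / (2 * p1 z) = (6 * p z ^ 2 - invariant_g2 L / 2) / p1 z"
      using nz by (simp add: field_simps)
    have x: "((6 * p z ^ 2 - invariant_g2 L / 2) / p1 z) ^ 2 / 4 - p z - p z = p (z + z)"
      using duplication_x[OF z1 z2 nz] unfolding mult_2 by (simp only: diff_diff_eq)
    have y: "(6 * p z ^ 2 - invariant_g2 L / 2) / p1 z * (p z - p (z + z)) - p1 z = p1 (z + z)"
      using duplication_y[OF z1 z2 nz] unfolding mult_2 by (rule sym)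
    show ?thesis
      unfolding w1 by (simp only: ec_add.simps ne l x y Let_def simp_thms if_True if_False)
  next
    case False
    have d: "z - ?w \<notin> L"
    proof
      assume "z - ?w \<in> L"
      from minus_in[OF this] have "of_nat (n - 1) * z \<in> L"
        using step.hyps by (simp add: of_nat_diff algebra_simps)
      moreover have "n - 1 \<ge> 1" using False step.hyps by simp
      ultimately show False using z by blast
    qed
    have ne: "p z \<noteq> p ?w"
    proof
      assume "p z = p ?w"
      then have "p ?w = p z" by simp
      moreover have "?w - z \<notin> L" using d minus_in[of "?w - z"] by auto
      moreover have "?w + z \<notin> L" using sum by (simp add: add.commute)
      ultimately have "p1 z = 0" by (intro wp_eq_imp_deriv_eq_zero[OF w z1])
      with nz show False by simp
    qed
    define l where "l = (p1 ?w - p1 z) / (p ?w - p z)"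
    have l: "(p1 z - p1 ?w) / (p z - p ?w) = l"
      unfolding l_def by (metis minus_diff_eq minus_divide_divide)
    have x: "l ^ 2 / 4 - p z - p ?w = p (z + ?w)"
      using addition_x[OF z1 w sum ne] unfolding l by (rule sym)
    have y: "l * (p z - p (z + ?w)) - p1 z = p1 (z + ?w)"
      using addition_y[OF z1 w sum ne] unfolding l by (rule sym)
    show ?thesis
      by (simp only: ec_add.simps ne l_def[symmetric] x y Let_def simp_thms if_True if_False)
  qed
  finally show ?case unfolding S .
qed

end

section \<open>The real period and the curve over (0, \<omega>)\<close>

locale real_lattice = complex_lattice +
  fixes g2 g3 \<omega> :: real
  assumes disc: "g2 ^ 3 - 27 * g3 ^ 2 \<noteq> 0"
    and g2: "invariant_g2 L = of_real g2" and g3: "invariant_g3 L = of_real g3"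
    and period: "is_real_period L \<omega>"
begin

lemma disc': "invariant_g2 L ^ 3 - 27 * invariant_g3 L ^ 2 \<noteq> 0"
proof -
  have "complex_of_real (g2 ^ 3 - 27 * g3 ^ 2) \<noteq> 0" using disc by (simp only: of_real_eq_0_iff not_False_eq_True)
  then show ?thesis by (simp add: g2 g3)
qed

lemma omega_pos: "\<omega> > 0"
  using period by (simp add: is_real_period_def)

lemma omega_le: "0 < t \<Longrightarrow> complex_of_real t \<in> L \<Longrightarrow> \<omega> \<le> t"
  using period unfolding is_real_period_def by blast

lemma of_int_omega_in: "complex_of_real (of_int k * \<omega>) \<in> L"
  using of_int_mult_in[of "of_real \<omega>" k] period by (simp add: is_real_period_def)

text \<open>Division with remainder by \<omega> leaves a lattice point in [0, \<omega>), which is 0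
  by minimality.\<close>

lemma real_in_lattice_iff: "complex_of_real t \<in> L \<longleftrightarrow> (\<exists>k::int. t = of_int k * \<omega>)"
proof
  assume t: "complex_of_real t \<in> L"
  define k where "k = \<lfloor>t / \<omega>\<rfloor>"
  have k: "of_int k * \<omega> \<le> t" "t < of_int k * \<omega> + \<omega>"
  proof -
    have "of_int k \<le> t / \<omega>" "t / \<omega> < of_int k + 1" unfolding k_def by linarith+
    then show "of_int k * \<omega> \<le> t" "t < of_int k * \<omega> + \<omega>"
      using omega_pos by (simp_all add: pos_le_divide_eq pos_divide_less_eq distrib_right)
  qed
  have "complex_of_real (t - of_int k * \<omega>) \<in> L"
    using diff_in[OF t of_int_omega_in[of k]] by simp
  then have "\<not> t - of_int k * \<omega> > 0"
    using omega_le[of "t - of_int k * \<omega>"] k by linarith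
  then show "\<exists>k::int. t = of_int k * \<omega>" using k by (intro exI[of _ k]) simp
qed (auto simp: of_int_omega_in simp del: of_real_mult)

lemma notin_lattice: "0 < t \<Longrightarrow> t < \<omega> \<Longrightarrow> complex_of_real t \<notin> L"
  using omega_le[of t] by linarith

lemma double_in_lattice: "0 < t \<Longrightarrow> t < \<omega> \<Longrightarrow> 2 * complex_of_real t \<in> L \<Longrightarrow> t = \<omega> / 2"
proof -
  assume t: "0 < t" "t < \<omega>" and "2 * complex_of_real t \<in> L"
  then have "complex_of_real (2 * t) \<in> L" by simp
  then obtain k :: int where k: "2 * t = of_int k * \<omega>" unfolding real_in_lattice_iff by blast
  have "0 < of_int k * \<omega>" "of_int k * \<omega> < 2 * \<omega>" using t k by linarith+
  then have "0 < k" "k < 2" using omega_pos by (simp_all add: zero_less_mult_iff)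
  then have "k = 1" by simp
  with k show ?thesis by simp
qed

definition real_wp where "real_wp t = Re (p (of_real t))"
definition real_wp' where "real_wp' t = Re (p1 (of_real t))"

lemma
  assumes "complex_of_real t \<notin> L"
  shows wp_of_real: "p (of_real t) = of_real (real_wp t)"
    and deriv_wp_of_real: "p1 (of_real t) = of_real (real_wp' t)"
    and real_curve: "real_wp' t ^ 2 = 4 * real_wp t ^ 3 - g2 * real_wp t - g3"
    and deriv_real_wp: "(real_wp has_field_derivative real_wp' t) (at t)"
    and deriv_real_wp': "(real_wp' has_field_derivative 6 * real_wp t ^ 2 - g2 / 2) (at t)"
proof -
  have sol: "weierstrass_solution (of_real g2) (of_real g3) L p p1"
    using solution_wp by (simp only: g2 g3)
  show 1: "p (of_real t) = of_real (real_wp t)" and 2: "p1 (of_real t) = of_real (real_wp' t)"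
    using weierstrass_solution_real[OF sol assms] by (simp_all add: real_wp_def real_wp'_def)
  have "complex_of_real (real_wp' t ^ 2) = of_real (4 * real_wp t ^ 3 - g2 * real_wp t - g3)"
    using curve[OF assms] unfolding 1 2 g2 g3 by simp
  then show "real_wp' t ^ 2 = 4 * real_wp t ^ 3 - g2 * real_wp t - g3" by (simp only: of_real_eq_iff)
  have re: "((\<lambda>t. Re (h (of_real t))) has_field_derivative Re D) (at t)"
    if "(h has_field_derivative D) (at (of_real t))" for h D
    using bounded_linear.has_vector_derivative[OF bounded_linear_Re has_vector_derivative_real_field[OF that]]
    by (simp only: has_real_derivative_iff_has_vector_derivative)
  show "(real_wp has_field_derivative real_wp' t) (at t)"
    using re[OF deriv_p[OF assms]] unfolding real_wp_def real_wp'_def .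
  have "Re (6 * p (of_real t) ^ 2 - invariant_g2 L / 2) = 6 * real_wp t ^ 2 - g2 / 2"
    unfolding 1 g2 by (simp flip: of_real_power)
  then show "(real_wp' has_field_derivative 6 * real_wp t ^ 2 - g2 / 2) (at t)"
    using re[OF deriv_p1[OF assms]] unfolding real_wp'_def by simp
qed

lemma real_wp'_eq_0: "0 < t \<Longrightarrow> t < \<omega> \<Longrightarrow> real_wp' t = 0 \<Longrightarrow> t = \<omega> / 2"
  using deriv_wp_nonzero[OF disc' notin_lattice[of t]] double_in_lattice[of t] deriv_wp_of_real[OF notin_lattice[of t]]
  by auto

text \<open>Two parameters with the same abscissa either add up to a lattice point, and then their
  ordinates are opposite, or an ordinate is 0. Equal nonzero signs exclude both.\<close>

lemma real_wp_eq_imp: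
  assumes t: "0 < t" "t < \<omega>" and u: "0 < u" "u < \<omega>" and eq: "real_wp t = real_wp u"
    and sgn: "real_wp' t * real_wp' u > 0"
  shows "t = u"
proof (rule ccontr)
  assume ne: "t \<noteq> u"
  note tL = notin_lattice[OF t] and uL = notin_lattice[OF u]
  have pe: "p (of_real t) = p (of_real u)" using wp_of_real[OF tL] wp_of_real[OF uL] eq by simp
  have "complex_of_real (t - u) \<notin> L"
  proof (cases "t < u")
    case True
    have "complex_of_real (u - t) \<notin> L" by (rule notin_lattice) (use True t u in auto)
    then show ?thesis using minus_iff[of "of_real (t - u)"] by simp
  next
    case False
    show ?thesis by (rule notin_lattice) (use False ne t u in auto)
  qed
  then have d: "complex_of_real t - of_real u \<notin> L" by simp
  show False
  proof (cases "complex_of_real t + of_real u \<in> L")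
    case True
    then have "p1 (- of_real u + (of_real t + of_real u)) = p1 (- of_real u)"
      by (rule deriv_wp_periodic)
    then have "p1 (of_real t) = - p1 (of_real u)" using deriv_wp_minus[OF uL] by simp
    then have "complex_of_real (real_wp' t) = of_real (- real_wp' u)"
      using deriv_wp_of_real[OF tL] deriv_wp_of_real[OF uL] by simp
    then have "real_wp' t = - real_wp' u" by (simp only: of_real_eq_iff)
    then show False using sgn by (simp add: zero_less_mult_iff)
  next
    case False
    have "p1 (of_real u) = 0" by (rule wp_eq_imp_deriv_eq_zero[OF tL uL False d pe])
    then have "real_wp' u = 0" using deriv_wp_of_real[OF uL] by simp
    then show False using sgn by simp
  qed
qed

end

section \<open>The two measures\<close>

lemma equidistribution_rmod:
  fixes z \<omega> c d :: real
  assumes \<omega>: "\<omega> > 0" and irr: "z / \<omega> \<notin> \<rat>" and cd: "0 \<le> c" "c \<le> d" "d \<le> \<omega>"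
    and X: "{c<..<d} \<subseteq> X" "X \<subseteq> {c..d}"
  shows "(\<lambda>N. real (visits (\<lambda>n. (real n * z) rmod \<omega>) X N) / real N) \<longlonglongrightarrow> (d - c) / \<omega>"
proof -
  let ?X = "{x. x * \<omega> \<in> X}"
  have "visits (\<lambda>n. (real n * z) rmod \<omega>) X N = visits (\<lambda>n. frac (real n * (z / \<omega>))) ?X N" for N
    using \<omega> by (simp add: visits_def rmod_conv_frac)
  moreover have "(\<lambda>N. real (visits (\<lambda>n. frac (real n * (z / \<omega>))) ?X N) / real N) \<longlonglongrightarrow> d / \<omega> - c / \<omega>"
  proof (rule equidistribution_frac[OF irr])
    show "0 \<le> c / \<omega>" "c / \<omega> \<le> d / \<omega>" "d / \<omega> \<le> 1"
      using cd \<omega> by (simp_all add: divide_right_mono)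
    show "{c / \<omega><..<d / \<omega>} \<subseteq> ?X"
    proof
      fix x assume "x \<in> {c / \<omega><..<d / \<omega>}"
      then have "x * \<omega> \<in> {c<..<d}" using \<omega> by (simp add: pos_divide_less_eq pos_less_divide_eq)
      then show "x \<in> ?X" using X(1) by blast
    qed
    show "?X \<subseteq> {c / \<omega>..d / \<omega>}"
    proof
      fix x assume "x \<in> ?X"
      then have "x * \<omega> \<in> {c..d}" using X(2) by blast
      then show "x \<in> {c / \<omega>..d / \<omega>}" using \<omega> by (simp add: pos_divide_le_eq pos_le_divide_eq)
    qed
  qed
  ultimately show ?thesis by (simp add: diff_divide_distrib)
qed

text \<open>The substitution x = f t turns the integrand into the constant 1, which is integrable as
  \<open>S\<close> is bounded. The substitution rule lives in Lebesgue measure, to which the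
  integral over \<open>lborel\<close> is carried by completion.\<close>

lemma nn_integral_image_reciprocal_derivative:
  fixes f f' g :: "real \<Rightarrow> real"
  assumes S: "S \<in> sets lebesgue" "bounded S" and inj: "inj_on f S"
    and der: "\<And>t. t \<in> S \<Longrightarrow> (f has_field_derivative f' t) (at t)"
    and recip: "\<And>t. t \<in> S \<Longrightarrow> \<bar>f' t\<bar> * g (f t) = 1" and nonneg: "\<And>x. x \<in> f ` S \<Longrightarrow> g x \<ge> 0"
  shows "(\<integral>\<^sup>+x\<in>f ` S. ennreal (g x) \<partial>lborel) = emeasure lebesgue S"
proof -
  have lm: "S \<in> lmeasurable" by (rule bounded_set_imp_lmeasurable[OF S(2,1)])
  have "(\<lambda>t. 1::real) absolutely_integrable_on S"
    using lm by (rule absolutely_integrable_on_const)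
  then have "(\<lambda>t. \<bar>f' t\<bar> * g (f t)) absolutely_integrable_on S"
    by (rule set_integrable_cong[THEN iffD1, rotated -1]) (simp_all add: recip)
  moreover have "integral S (\<lambda>t. \<bar>f' t\<bar> * g (f t)) = integral S (\<lambda>t. 1)"
    by (rule integral_cong) (rule recip)
  then have "integral S (\<lambda>t. \<bar>f' t\<bar> * g (f t)) = measure lebesgue S"
    by (simp only: lmeasure_integral[OF lm])
  ultimately have g: "g absolutely_integrable_on (f ` S)" "integral (f ` S) g = measure lebesgue S"
    using has_absolute_integral_change_of_variables_1'[OF S(1) has_field_derivative_at_within[OF der] inj]
    by blast+
  have "(\<integral>\<^sup>+x\<in>f ` S. ennreal (g x) \<partial>lborel) = (\<integral>\<^sup>+x\<in>f ` S. ennreal (g x) \<partial>lebesgue)"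
    by (rule nn_integral_completion[symmetric])
  also have "\<dots> = (\<integral>\<^sup>+x. ennreal (indicator (f ` S) x *\<^sub>R g x) \<partial>lebesgue)"
    by (intro nn_integral_cong) (simp split: split_indicator)
  also have "\<dots> = ennreal (LINT x:f ` S|lebesgue. g x)"
    unfolding set_lebesgue_integral_def
    by (intro nn_integral_eq_integral g(1)[unfolded set_integrable_def] AE_I2)
       (simp add: nonneg split: split_indicator)
  also have "\<dots> = ennreal (measure lebesgue S)"
    using set_lebesgue_integral_eq_integral(2)[OF g(1)] g(2) by simp
  also have "\<dots> = emeasure lebesgue S"
    using lm by (simp add: emeasure_eq_measure2)
  finally show ?thesis .
qed

section \<open>The measure dx/|y| in the parameter t\<close>

context real_lattice
begin

lemma branch_abscissae_eq:
  "branch_abscissae L \<omega> \<sigma> X = real_wp ` {t \<in> X \<inter> {0<..<\<omega>}. sgn (real_wp' t) = \<sigma>}"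
proof -
  have gam: "gam L t = (of_real (real_wp t), of_real (real_wp' t))" if "t \<in> {0<..<\<omega>}" for t
    unfolding gam_def using that by (simp add: wp_of_real deriv_wp_of_real notin_lattice)
  show ?thesis
  proof (intro equalityI subsetI)
    fix x assume "x \<in> branch_abscissae L \<omega> \<sigma> X"
    then obtain y t where y: "sgn y = \<sigma>" and t: "t \<in> X \<inter> {0<..<\<omega>}"
      and e: "(of_real x, of_real y) = gam L t"
      unfolding branch_abscissae_def by blast
    have "x = real_wp t" "y = real_wp' t" using e gam[of t] t by simp_all
    then show "x \<in> real_wp ` {t \<in> X \<inter> {0<..<\<omega>}. sgn (real_wp' t) = \<sigma>}" using y t by blast
  next
    fix x assume "x \<in> real_wp ` {t \<in> X \<inter> {0<..<\<omega>}. sgn (real_wp' t) = \<sigma>}"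
    then obtain t where t: "x = real_wp t" "t \<in> X \<inter> {0<..<\<omega>}" "sgn (real_wp' t) = \<sigma>" by blast
    have "(of_real x, of_real (real_wp' t)) \<in> gam L ` (X \<inter> {0<..<\<omega>})"
      using gam[of t] t(1,2) by (intro image_eqI[of _ _ t]) simp_all
    then show "x \<in> branch_abscissae L \<omega> \<sigma> X"
      unfolding branch_abscissae_def using t(3) by blast
  qed
qed

lemma continuous_real_wp': "continuous_on {0<..<\<omega>} real_wp'"
  by (intro continuous_at_imp_continuous_on ballI DERIV_isCont[OF deriv_real_wp'] notin_lattice) simp_all

text \<open>The curve equation identifies the square root with |\<open>real_wp'\<close>|, and the
  fixed sign of the ordinate makes the abscissa injective.\<close>

lemma branch_measure:
  fixes c d \<sigma> :: real
  assumes \<sigma>: "\<sigma> = 1 \<or> \<sigma> = - 1"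
  defines "S \<equiv> {t \<in> {c..d} \<inter> {0<..<\<omega>}. sgn (real_wp' t) = \<sigma>}"
  shows "S \<in> sets lborel"
    and "(\<integral>\<^sup>+x\<in>branch_abscissae L \<omega> \<sigma> {c..d}. ennreal (1 / sqrt (4 * x ^ 3 - g2 * x - g3)) \<partial>lborel)
      = emeasure lborel S"
proof -
  have "S = {c..d} \<inter> ({0<..<\<omega>} \<inter> real_wp' -` (if \<sigma> = 1 then {0<..} else {..<0}))"
    using \<sigma> by (auto simp: S_def sgn_if split: if_splits)
  moreover have "open ({0<..<\<omega>} \<inter> real_wp' -` (if \<sigma> = 1 then {0<..} else {..<0}))"
    by (rule continuous_open_preimage[OF continuous_real_wp']) auto
  ultimately show S: "S \<in> sets lborel" by simp
  have tL: "complex_of_real t \<notin> L" if "t \<in> S" for t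
    using that by (intro notin_lattice) (auto simp: S_def)
  have nz: "real_wp' t \<noteq> 0" if "t \<in> S" for t
  proof
    assume "real_wp' t = 0"
    then have "\<sigma> = 0" using that by (simp add: S_def)
    then show False using \<sigma> by simp
  qed
  have root: "sqrt (4 * real_wp t ^ 3 - g2 * real_wp t - g3) = \<bar>real_wp' t\<bar>" if "t \<in> S" for t
    by (simp only: real_curve[OF tL[OF that], symmetric] real_sqrt_abs)
  have "inj_on real_wp S"
  proof (rule inj_onI)
    fix t u assume tu: "t \<in> S" "u \<in> S" "real_wp t = real_wp u"
    have "sgn (real_wp' t * real_wp' u) = 1" using tu \<sigma> by (auto simp: S_def sgn_mult)
    then have pos: "real_wp' t * real_wp' u > 0" by (simp only: sgn_1_pos)
    have "0 < t" "t < \<omega>" "0 < u" "u < \<omega>" using tu(1,2) by (simp_all add: S_def)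
    then show "t = u" using tu(3) pos by (rule real_wp_eq_imp)
  qed
  then have "(\<integral>\<^sup>+x\<in>real_wp ` S. ennreal (1 / sqrt (4 * x ^ 3 - g2 * x - g3)) \<partial>lborel) = emeasure lebesgue S"
  proof (rule nn_integral_image_reciprocal_derivative[rotated 2])
    show "S \<in> sets lebesgue" using S by simp
    show "bounded S" by (rule bounded_subset[of "{c..d}"]) (auto simp: S_def)
    show "(real_wp has_field_derivative real_wp' t) (at t)" if "t \<in> S" for t
      by (rule deriv_real_wp[OF tL[OF that]])
    show "\<bar>real_wp' t\<bar> * (1 / sqrt (4 * real_wp t ^ 3 - g2 * real_wp t - g3)) = 1" if "t \<in> S" for t
      using nz[OF that] by (simp add: root[OF that])
    show "0 \<le> 1 / sqrt (4 * x ^ 3 - g2 * x - g3)" if x: "x \<in> real_wp ` S" for x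
    proof -
      obtain t where "x = real_wp t" "t \<in> S" using x by blast
      then show ?thesis using root[of t] by simp
    qed
  qed
  then show "(\<integral>\<^sup>+x\<in>branch_abscissae L \<omega> \<sigma> {c..d}. ennreal (1 / sqrt (4 * x ^ 3 - g2 * x - g3)) \<partial>lborel)
      = emeasure lborel S"
    unfolding branch_abscissae_eq S_def[symmetric] using emeasure_completion[of S lborel] S by simp
qed

lemma dxy_measure_interval:
  assumes cd: "0 \<le> c" "c \<le> d" "d \<le> \<omega>"
  shows "dxy_measure g2 g3 L \<omega> {c..d} = ennreal ((d - c) / \<omega>)"
proof -
  define S where "S = (\<lambda>\<sigma>. {t \<in> {c..d} \<inter> {0<..<\<omega>}. sgn (real_wp' t) = \<sigma>})"
  have S: "S 1 \<in> sets lborel" "S (- 1) \<in> sets lborel"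
    unfolding S_def by (rule branch_measure(1); simp)+
  have "emeasure lborel (S 1) + emeasure lborel (S (- 1)) = emeasure lborel (S 1 \<union> S (- 1))"
    by (rule plus_emeasure[OF S]) (auto simp: S_def)
  also have "\<dots> = ennreal (d - c)"
  proof (rule antisym)
    have "emeasure lborel (S 1 \<union> S (- 1)) \<le> emeasure lborel {c..d}"
      by (rule emeasure_mono) (auto simp: S_def)
    then show "emeasure lborel (S 1 \<union> S (- 1)) \<le> ennreal (d - c)" using cd by simp
    \<comment> \<open>The ordinate can vanish only at \<omega>/2, so the two branches together cover
      the interval up to a null set.\<close>
    have sub: "{c<..<d} - {\<omega> / 2} \<subseteq> S 1 \<union> S (- 1)"
    proof
      fix t assume t: "t \<in> {c<..<d} - {\<omega> / 2}"
      then have t0: "0 < t" "t < \<omega>" using cd by auto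
      have "real_wp' t \<noteq> 0" using real_wp'_eq_0[OF t0] t by blast
      then have "sgn (real_wp' t) = 1 \<or> sgn (real_wp' t) = - 1" by (simp add: sgn_if)
      then show "t \<in> S 1 \<union> S (- 1)" using t t0 by (auto simp: S_def)
    qed
    have "ennreal (d - c) = emeasure lborel {c<..<d}" using cd by simp
    also have "\<dots> = emeasure lborel ({c<..<d} - {\<omega> / 2})"
      by (rule emeasure_Diff_null_set[symmetric]) auto
    also have "\<dots> \<le> emeasure lborel (S 1 \<union> S (- 1))"
      by (rule emeasure_mono[OF sub]) (use S in auto)
    finally show "ennreal (d - c) \<le> emeasure lborel (S 1 \<union> S (- 1))" .
  qed
  finally have "dxy_measure g2 g3 L \<omega> {c..d} = ennreal (d - c) / ennreal \<omega>"
    unfolding dxy_measure_def S_def by (simp add: branch_measure(2))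
  then show ?thesis using cd omega_pos by (simp add: divide_ennreal)
qed

section \<open>Arc length near the pole and failure of equidistribution\<close>

lemma norm_vector_derivative_gam:
  assumes "complex_of_real t \<notin> L"
  shows "norm (vector_derivative (gam L) (at t)) \<ge> norm (p1 (of_real t))"
proof -
  have "((\<lambda>t. (p (of_real t), p1 (of_real t))) has_vector_derivative
      (p1 (of_real t), 6 * p (of_real t) ^ 2 - invariant_g2 L / 2)) (at t)"
    by (intro has_vector_derivative_Pair has_vector_derivative_real_field deriv_p deriv_p1 assms)
  then have "(gam L has_vector_derivative
      (p1 (of_real t), 6 * p (of_real t) ^ 2 - invariant_g2 L / 2)) (at t)"
    unfolding gam_def[abs_def] .
  from vector_derivative_at[OF this] show ?thesis by (simp only: norm_fst_le)
qed

lemma norm_deriv_wp_ge: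
  "\<exists>e>0. \<forall>t. 0 < t \<longrightarrow> t < e \<longrightarrow> norm (p1 (complex_of_real t)) \<ge> 2 / t ^ 3 - 1"
proof -
  have "\<forall>\<^sub>F z in at 0. dist (p1 z + 2 / z ^ 3) 0 < 1"
    by (rule tendstoD[OF pole1]) simp
  then obtain e where e: "e > 0" "\<And>z. z \<noteq> 0 \<Longrightarrow> dist z 0 < e \<Longrightarrow> dist (p1 z + 2 / z ^ 3) 0 < 1"
    unfolding eventually_at by auto
  have "norm (p1 (complex_of_real t)) \<ge> 2 / t ^ 3 - 1" if t: "0 < t" "t < e" for t
  proof -
    have "norm (p1 (of_real t) + 2 / complex_of_real t ^ 3) < 1"
      using e(2)[of "of_real t"] t by simp
    moreover have "norm (2 / complex_of_real t ^ 3) = 2 / t ^ 3"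
      using t by (simp add: norm_divide norm_power)
    ultimately show ?thesis
      using norm_diff_ineq[of "2 / complex_of_real t ^ 3" "p1 (of_real t)"]
      by (simp add: add.commute)
  qed
  with e(1) show ?thesis by blast
qed

lemma arc_measure_mono: "X \<subseteq> Y \<Longrightarrow> arc_measure L X \<le> arc_measure L Y"
  unfolding arc_measure_def by (intro nn_integral_mono) (auto split: split_indicator)

text \<open>The average speed on an interval of length \<epsilon> near 0 can be made as large as
  desired.\<close>

lemma arc_measure_near_zero:
  assumes K: "K \<ge> 0"
  shows "\<exists>\<epsilon>>0. 2 * \<epsilon> < \<omega> \<and> arc_measure L {\<epsilon>..2 * \<epsilon>} \<ge> ennreal (K * \<epsilon>)"
proof -
  obtain e where e: "e > 0" "\<And>t. 0 < t \<Longrightarrow> t < e \<Longrightarrow> norm (p1 (complex_of_real t)) \<ge> 2 / t ^ 3 - 1"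
    using norm_deriv_wp_ge by blast
  \<comment> \<open>The bound 1 gives t^3 at most t, and 2/(K + 1) gives 2/t at least K + 1;
    together the speed 2/t^3 - 1 is at least K.\<close>
  define \<delta> where "\<delta> = min (min e \<omega>) (min 1 (2 / (K + 1)))"
  define \<epsilon> where "\<epsilon> = \<delta> / 4"
  have \<delta>: "\<delta> > 0" "\<delta> \<le> e" "\<delta> \<le> \<omega>" "\<delta> \<le> 1" "\<delta> \<le> 2 / (K + 1)"
    using e(1) omega_pos K by (simp_all add: \<delta>_def)
  have \<epsilon>: "\<epsilon> > 0" "2 * \<epsilon> < \<delta>" using \<delta> by (simp_all add: \<epsilon>_def)
  have dens: "K \<le> norm (vector_derivative (gam L) (at t))" if t: "t \<in> {\<epsilon>..2 * \<epsilon>}" for t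
  proof -
    have t1: "0 < t" "t < \<delta>" "t \<le> 1" using t \<epsilon> \<delta> by auto
    have "t ^ 3 \<le> t" using t1 power_decreasing[of 1 3 t] by simp
    then have "2 / t \<le> 2 / t ^ 3" using t1 by (intro divide_left_mono) auto
    moreover have "K + 1 \<le> 2 / t"
    proof -
      have "t \<le> 2 / (K + 1)" using t1 \<delta> by linarith
      then have "t * (K + 1) \<le> 2" using K pos_le_divide_eq[of "K + 1" t 2] by simp
      then show ?thesis using t1 by (simp add: pos_le_divide_eq mult.commute)
    qed
    ultimately have "K \<le> norm (p1 (of_real t))"
      using e(2)[of t] t1 \<delta> by linarith
    also have "\<dots> \<le> norm (vector_derivative (gam L) (at t))"
      by (intro norm_vector_derivative_gam notin_lattice) (use t1 \<delta> in linarith)+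
    finally show ?thesis .
  qed
  have "ennreal (K * \<epsilon>) = ennreal K * emeasure lborel {\<epsilon>..2 * \<epsilon>}"
    using K \<epsilon> by (simp add: ennreal_mult)
  also have "\<dots> = (\<integral>\<^sup>+t. ennreal K * indicator {\<epsilon>..2 * \<epsilon>} t \<partial>lborel)"
    by (rule nn_integral_cmult_indicator[symmetric]) simp
  also have "\<dots> \<le> arc_measure L {\<epsilon>..2 * \<epsilon>}"
    unfolding arc_measure_def
    by (intro nn_integral_mono) (use dens in \<open>auto split: split_indicator intro!: ennreal_leI\<close>)
  finally show ?thesis using \<epsilon> \<delta> by (intro exI[of _ \<epsilon>]) auto
qed

text \<open>The offset 3 makes already the first interval nonempty: it is (\<omega>/3,
  2\<omega>/3).\<close>

lemma exhausting_intervals_example: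
  "exhausting_intervals \<omega> (\<lambda>k. \<omega> / real (k + 3)) (\<lambda>k. \<omega> - \<omega> / real (k + 3))"
  unfolding exhausting_intervals_def
proof (intro conjI allI)
  fix k :: nat
  have "\<omega> / real (k + 3) \<le> \<omega> / 3" using omega_pos by (intro divide_left_mono) auto
  then show "\<omega> / real (k + 3) < \<omega> - \<omega> / real (k + 3)" using omega_pos by linarith
  show "\<omega> / real (k + 3) \<noteq> 0" "\<omega> - \<omega> / real (k + 3) \<noteq> \<omega>" using omega_pos by simp_all
  have "\<omega> / real (Suc k + 3) \<le> \<omega> / real (k + 3)" using omega_pos by (intro divide_left_mono) auto
  then show "{\<omega> / real (k + 3)<..<\<omega> - \<omega> / real (k + 3)}
      \<subseteq> {\<omega> / real (Suc k + 3)<..<\<omega> - \<omega> / real (Suc k + 3)}" by auto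
next
  show "(\<Union>k. {\<omega> / real (k + 3)<..<\<omega> - \<omega> / real (k + 3)}) = {0<..<\<omega>}"
  proof (intro equalityI subsetI)
    fix t assume "t \<in> (\<Union>k. {\<omega> / real (k + 3)<..<\<omega> - \<omega> / real (k + 3)})"
    then obtain k where k: "\<omega> / real (k + 3) < t" "t < \<omega> - \<omega> / real (k + 3)" by auto
    have "0 < \<omega> / real (k + 3)" using omega_pos by simp
    then show "t \<in> {0<..<\<omega>}" using k by simp
  next
    fix t assume t: "t \<in> {0<..<\<omega>}"
    define m where "m = min t (\<omega> - t)"
    have m: "m > 0" using t by (simp add: m_def)
    obtain k :: nat where "\<omega> / m < real k" using reals_Archimedean2 by blast
    then have "\<omega> / m < real (k + 3)" by simp
    then have "\<omega> / real (k + 3) < m" using m by (simp add: field_simps)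
    then show "t \<in> (\<Union>k. {\<omega> / real (k + 3)<..<\<omega> - \<omega> / real (k + 3)})"
      by (intro UN_I[of k]) (auto simp: m_def)
  qed
qed

text \<open>Two intervals inside the same A_k would have the same arc length per unit of parameter.
  A fixed interval in the middle is compared with one close to 0.\<close>

lemma not_equidistributed_arc:
  assumes irr: "z / \<omega> \<notin> \<rat>"
  shows "\<not> equidistributed_arc L \<omega> (\<lambda>n. (real n * z) rmod \<omega>)"
proof
  let ?s = "\<lambda>n. (real n * z) rmod \<omega>"
  assume equi: "equidistributed_arc L \<omega> ?s"
  define a where "a = (\<lambda>k. \<omega> / real (k + 3))"
  define b where "b = (\<lambda>k. \<omega> - \<omega> / real (k + 3))"
  have exh: "exhausting_intervals \<omega> a b"
    unfolding a_def b_def by (rule exhausting_intervals_example)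
  define M where "M = arc_measure L"
  have proportional: "enn2real (M {c..d}) = (d - c) / (b k - a k) * enn2real (M {a k<..<b k})"
    "M {c..d} \<noteq> \<infinity>" if cd: "a k < c" "c < d" "d < b k" for c d k
  proof -
    have ab: "0 < a k" "b k < \<omega>" using omega_pos by (simp_all add: a_def b_def)
    have sub: "{c..d} \<subseteq> {a k<..<b k}" using cd by auto
    then have I: "{c..d} \<inter> {a k<..<b k} = {c..d}" by blast
    have lim: "(\<lambda>N. real (visits ?s {c..d} N) / real (visits ?s {a k<..<b k} N))
        \<longlonglongrightarrow> enn2real (M {c..d} / M {a k<..<b k})"
    proof -
      have "0 \<le> c" "c \<le> d" "d \<le> \<omega>" using cd ab by linarith+
      then have "(\<lambda>N. real (visits ?s ({c..d} \<inter> {a k<..<b k}) N) / real (visits ?s {a k<..<b k} N))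
        \<longlonglongrightarrow> enn2real (arc_measure L ({c..d} \<inter> {a k<..<b k}) / arc_measure L {a k<..<b k})"
        using equi exh unfolding equidistributed_arc_def by blast
      then show ?thesis unfolding I M_def .
    qed
    have l1: "(\<lambda>N. real (visits ?s {c..d} N) / real N) \<longlonglongrightarrow> (d - c) / \<omega>"
      by (rule equidistribution_rmod[OF omega_pos irr]) (use cd ab in auto)
    have l2: "(\<lambda>N. real (visits ?s {a k<..<b k} N) / real N) \<longlonglongrightarrow> (b k - a k) / \<omega>"
      by (rule equidistribution_rmod[OF omega_pos irr]) (use cd ab in auto)
    have nz: "(b k - a k) / \<omega> \<noteq> 0" using cd omega_pos by simp
    have "(\<lambda>N. (real (visits ?s {c..d} N) / real N) / (real (visits ?s {a k<..<b k} N) / real N))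
        \<longlonglongrightarrow> ((d - c) / \<omega>) / ((b k - a k) / \<omega>)"
      by (rule tendsto_divide[OF l1 l2 nz])
    moreover have "\<forall>\<^sub>F N in sequentially.
        (real (visits ?s {c..d} N) / real N) / (real (visits ?s {a k<..<b k} N) / real N)
        = real (visits ?s {c..d} N) / real (visits ?s {a k<..<b k} N)"
      using eventually_gt_at_top[of 0] by eventually_elim simp
    ultimately have "(\<lambda>N. real (visits ?s {c..d} N) / real (visits ?s {a k<..<b k} N))
        \<longlonglongrightarrow> ((d - c) / \<omega>) / ((b k - a k) / \<omega>)"
      by (rule Lim_transform_eventually)
    from LIMSEQ_unique[OF lim this]
    have ratio: "enn2real (M {c..d} / M {a k<..<b k}) = (d - c) / (b k - a k)"
      using omega_pos by simp
    have pos: "(d - c) / (b k - a k) > 0" using cd by simp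
    have mono: "M {c..d} \<le> M {a k<..<b k}" unfolding M_def by (rule arc_measure_mono[OF sub])
    \<comment> \<open>An infinite or zero arc length of A_k would make the quotient 0 under the
      conventions of extended division, whereas the ratio is positive.\<close>
    have "M {a k<..<b k} \<noteq> \<infinity>"
    proof
      assume "M {a k<..<b k} = \<infinity>"
      then have "enn2real (M {c..d} / M {a k<..<b k}) = 0" by simp
      with ratio pos show False by linarith
    qed
    moreover have "M {a k<..<b k} \<noteq> 0"
    proof
      assume "M {a k<..<b k} = 0"
      then have "enn2real (M {c..d} / M {a k<..<b k}) = 0" using mono by simp
      with ratio pos show False by linarith
    qed
    ultimately have \<alpha>: "M {a k<..<b k} = ennreal (enn2real (M {a k<..<b k}))"
      "enn2real (M {a k<..<b k}) > 0"
      by (simp_all add: enn2real_positive_iff less_top zero_less_iff_neq_zero)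
    show fin: "M {c..d} \<noteq> \<infinity>"
      using mono \<open>M {a k<..<b k} \<noteq> \<infinity>\<close> by (auto simp: top_unique)
    have \<beta>: "M {c..d} = ennreal (enn2real (M {c..d}))" using fin by (simp add: less_top)
    have "M {c..d} / M {a k<..<b k} = ennreal (enn2real (M {c..d}) / enn2real (M {a k<..<b k}))"
      by (subst \<alpha>(1), subst \<beta>, rule divide_ennreal) (use \<alpha>(2) in auto)
    then have "enn2real (M {c..d}) / enn2real (M {a k<..<b k}) = (d - c) / (b k - a k)"
      using ratio \<alpha>(2) by simp
    then show "enn2real (M {c..d}) = (d - c) / (b k - a k) * enn2real (M {a k<..<b k})"
      using \<alpha>(2) by (simp add: divide_eq_eq)
  qed
  \<comment> \<open>The average speed on the reference interval, to be exceeded by 1 on the interval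
    near 0.\<close>
  define K where "K = enn2real (M {\<omega> / 2..3 / 4 * \<omega>}) / (\<omega> / 4)"
  have "K \<ge> 0" using omega_pos by (simp add: K_def)
  then obtain \<epsilon> where \<epsilon>: "\<epsilon> > 0" "2 * \<epsilon> < \<omega>" and big: "M {\<epsilon>..2 * \<epsilon>} \<ge> ennreal ((K + 1) * \<epsilon>)"
    using arc_measure_near_zero[of "K + 1"] unfolding M_def by auto
  \<comment> \<open>Once \<open>a k\<close> is below \<open>m\<close>, both intervals lie inside
    A_k, since \<open>b k = \<omega> - a k\<close>.\<close>
  define m where "m = min \<epsilon> (min (\<omega> - 2 * \<epsilon>) (\<omega> / 4))"
  have m: "m > 0" using \<epsilon> omega_pos by (simp add: m_def)
  obtain k :: nat where "\<omega> / m < real k" using reals_Archimedean2 by blast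
  then have "\<omega> / m < real (k + 3)" by simp
  then have am: "a k < m" using m by (simp add: a_def field_simps)
  have bk: "b k = \<omega> - a k" by (simp add: a_def b_def)
  have mm: "m \<le> \<epsilon>" "m \<le> \<omega> - 2 * \<epsilon>" "m \<le> \<omega> / 4"
    unfolding m_def by linarith+
  have 1: "a k < \<epsilon>" "\<epsilon> < 2 * \<epsilon>" "2 * \<epsilon> < b k" using am mm \<epsilon> bk by linarith+
  have 2: "a k < \<omega> / 2" "\<omega> / 2 < 3 / 4 * \<omega>" "3 / 4 * \<omega> < b k" using am mm omega_pos bk by linarith+
  define q where "q = enn2real (M {a k<..<b k}) / (b k - a k)"
  have "enn2real (M {\<omega> / 2..3 / 4 * \<omega>}) = (\<omega> / 4) * q"
    using proportional(1)[OF 2] by (simp add: q_def)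
  then have "K = q" using omega_pos by (simp add: K_def)
  moreover have "enn2real (M {\<epsilon>..2 * \<epsilon>}) = \<epsilon> * q"
    using proportional(1)[OF 1] by (simp add: q_def)
  moreover have "(K + 1) * \<epsilon> \<le> enn2real (M {\<epsilon>..2 * \<epsilon>})"
    using enn2real_mono[OF big] proportional(2)[OF 1] \<epsilon> \<open>K \<ge> 0\<close> by (simp add: less_top)
  ultimately show False using \<epsilon> by (simp add: algebra_simps)
qed

lemma equidistributed_dxy_rmod:
  assumes irr: "z / \<omega> \<notin> \<rat>"
  shows "equidistributed_dxy g2 g3 L \<omega> (\<lambda>n. (real n * z) rmod \<omega>)"
  unfolding equidistributed_dxy_def
proof (intro allI impI)
  fix c d assume "0 \<le> c \<and> c \<le> d \<and> d \<le> \<omega>"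
  then have cd: "0 \<le> c" "c \<le> d" "d \<le> \<omega>" by simp_all
  have "(\<lambda>N. real (visits (\<lambda>n. (real n * z) rmod \<omega>) {c..d} N) / real N) \<longlonglongrightarrow> (d - c) / \<omega>"
    by (rule equidistribution_rmod[OF omega_pos irr cd]) auto
  moreover have "enn2real (dxy_measure g2 g3 L \<omega> {c..d}) = (d - c) / \<omega>"
    unfolding dxy_measure_interval[OF cd] using cd omega_pos by simp
  ultimately show "(\<lambda>N. real (visits (\<lambda>n. (real n * z) rmod \<omega>) {c..d} N) / real N)
      \<longlonglongrightarrow> enn2real (dxy_measure g2 g3 L \<omega> {c..d})" by simp
qed

end

theorem theorem15:
  fixes g2 g3 \<omega> z :: real and \<Lambda> :: "complex set"
    and P :: "complex ec_point" and s :: "nat \<Rightarrow> real"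
  assumes "g2 ^ 3 - 27 * g3 ^ 2 \<noteq> 0"
    and "is_lattice \<Lambda>"
    and "invariant_g2 \<Lambda> = of_real g2"
    and "invariant_g3 \<Lambda> = of_real g3"
    and "is_real_period \<Lambda> \<omega>"
    and "z \<notin> (\<lambda>q. \<omega> * q) ` \<rat>"
    and "P = Affine (wp \<Lambda> (of_real z), deriv (wp \<Lambda>) (of_real z))"
    and "\<And>n. s n = (real n * z) rmod \<omega>"
  shows "P \<in> real_points g2 g3 \<and>
    (\<forall>n\<ge>1. s n \<in> {0<..<\<omega>} \<and> ec_mult (of_real g2) n P = Affine (gam \<Lambda> (s n))) \<and>
    \<not> equidistributed_arc \<Lambda> \<omega> s \<and>
    equidistributed_dxy g2 g3 \<Lambda> \<omega> s"
proof -
  interpret real_lattice \<Lambda> g2 g3 \<omega>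
    by unfold_locales (fact assms)+
  have irr: "z / \<omega> \<notin> \<rat>"
  proof
    assume "z / \<omega> \<in> \<rat>"
    then have "\<omega> * (z / \<omega>) \<in> (\<lambda>q. \<omega> * q) ` \<rat>" by (rule imageI)
    then show False using assms(6) omega_pos by simp
  qed
  have nz: "complex_of_real (real n * z) \<notin> \<Lambda>" if "n \<ge> 1" for n
  proof
    assume "complex_of_real (real n * z) \<in> \<Lambda>"
    then obtain k :: int where k: "real n * z = of_int k * \<omega>"
      unfolding real_in_lattice_iff by blast
    then have "z / \<omega> = of_int k / of_nat n" using that omega_pos by (simp add: field_simps)
    then show False using irr by simp
  qed
  have zL: "complex_of_real z \<notin> \<Lambda>" using nz[of 1] by simp
  have s: "s = (\<lambda>n. (real n * z) rmod \<omega>)" using assms(8) by blast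
  have "P \<in> real_points g2 g3"
    unfolding real_points_def assms(7) wp_of_real[OF zL] deriv_wp_of_real[OF zL]
    using real_curve[OF zL] by blast
  moreover have "s n \<in> {0<..<\<omega>} \<and> ec_mult (of_real g2) n P = Affine (gam \<Lambda> (s n))" if n: "n \<ge> 1" for n
  proof -
    \<comment> \<open>Reduction modulo \<omega> adds the lattice point k\<omega>, which changes
      neither \<open>wp\<close> nor its derivative.\<close>
    define k where "k = - \<lfloor>real n * z / \<omega>\<rfloor>"
    have sn: "s n = real n * z + of_int k * \<omega>"
      using omega_pos by (simp add: s rmod_def k_def)
    have per: "complex_of_real (of_int k * \<omega>) \<in> \<Lambda>" by (rule of_int_omega_in)
    have sn': "complex_of_real (s n) = of_real (real n * z) + of_real (of_int k * \<omega>)"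
      unfolding sn by (rule of_real_add)
    have "complex_of_real (s n) \<notin> \<Lambda>"
      using add_iff[OF per] nz[OF n] unfolding sn' by blast
    then have "s n \<noteq> 0" by auto
    moreover have "0 \<le> s n" "s n < \<omega>"
      using omega_pos by (simp_all add: s rmod_nonneg rmod_less)
    moreover have "ec_mult (of_real g2) n P = Affine (gam \<Lambda> (s n))"
    proof -
      have "of_nat m * complex_of_real z \<notin> \<Lambda>" if "m \<ge> 1" for m
        using nz[OF that] by simp
      from ec_mult_wp[OF disc' this n]
      have "ec_mult (of_real g2) n P
          = Affine (p (of_nat n * of_real z), p1 (of_nat n * of_real z))"
        unfolding assms(7) g2 .
      also have "\<dots> = Affine (gam \<Lambda> (s n))"
        unfolding gam_def sn' wp_periodic[OF per] deriv_wp_periodic[OF per] by simp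
      finally show ?thesis .
    qed
    ultimately show ?thesis by simp
  qed
  ultimately show ?thesis
    unfolding s using not_equidistributed_arc[OF irr] equidistributed_dxy_rmod[OF irr] by blast
qed

end
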